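(* Let $T$ be a weighted tree with leaves $1,\dots,n$ and let $D_{i,j}=D_{i,j}(T)$ for all $i,j\in[n]$. For $i\ne j$ put $$S_{i,j}:=(n-2)D_{i,j}-\sum_{k\ne i}D_{i,k}-\sum_{k\ne j}D_{j,k}.$$ For every column $j$ of the matrix $S$ (defined except on the diagonal) let $m_j$ be the minimum of the column and let $i_j:=\min\{i\mid S_{i,j}=m_j\}$. For each of the $n$ couples $(i_j,j)$ consider the difference between the $i_j$-th column and the $j$-th column of the matrix $D$. - If this difference has all coefficients equal (except for the $j$-th and the $i_j$-th entries), then $i_j$ and $j$ are neighbours. - If this difference does not have all coefficients equal (except for the $j$-th and the $i_j$-th entries), then $j$ is not in any cherry. Keep, of the $n$ couples $(i_j,j)$, only those for which the difference has all coefficients equal (except for the $j$-th and the $i_j$-th entries). In this way, for every cherry of $T$, all its leaves are found. So, by $O(n^2)$ elementary operations in all, ALL the cherries of the tree are found.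
   Context: $[n]=\{1,\dots,n\}$. A weighted tree is a tree each of whose edges is endowed with a real number, called the weight or length of the edge. $D_{i,j}(T)$ is the sum of the lengths of the edges of the path joining the leaves $i$ and $j$; $D$ is the matrix with entries $D_{i,j}$. A 2-cherry in a tree is a subtree with two leaves such that only one of its inner vertices is not bivalent (of degree $2$ in the tree); this vertex is called its stalk, and the two leaves are called neighbours. A cherry is a union of 2-cherries with the same stalk.
   Formalization: Added: n ≥ 3, and every internal edge (not between a leaf and the first vertex of degree ≥ 3) has positive weight; other weights are arbitrary reals. Without this the claim fails: the quartet tree 12|34 with internal weight -1 or 0; for n = 2 the test is vacuous but no 2-cherry exists. *)

theory Defs
  imports Complex_Main
begin

section \<open>Finite simple graphs and trees\<close>

type_synonym 'v graph = "'v set \<times> 'v set set"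

abbreviation verts :: "'v graph \<Rightarrow> 'v set" where "verts \<equiv> fst"
abbreviation edges :: "'v graph \<Rightarrow> 'v set set" where "edges \<equiv> snd"

definition simple_graph :: "'v graph \<Rightarrow> bool" where
  "simple_graph G \<longleftrightarrow> finite (verts G) \<and> (\<forall>e\<in>edges G. e \<subseteq> verts G \<and> card e = 2)"

definition is_path :: "'v graph \<Rightarrow> 'v list \<Rightarrow> bool" where
  "is_path G p \<longleftrightarrow> p \<noteq> [] \<and> distinct p \<and> set p \<subseteq> verts G
     \<and> successively (\<lambda>u v. {u, v} \<in> edges G) p"

definition path_between :: "'v graph \<Rightarrow> 'v \<Rightarrow> 'v \<Rightarrow> 'v list \<Rightarrow> bool" where
  "path_between G u v p \<longleftrightarrow> is_path G p \<and> hd p = u \<and> last p = v"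

definition path_edges :: "'v list \<Rightarrow> 'v set set" where
  "path_edges p = (\<lambda>(u, v). {u, v}) ` set (zip p (tl p))"

definition tree :: "'v graph \<Rightarrow> bool" where
  "tree G \<longleftrightarrow> simple_graph G \<and> verts G \<noteq> {}
     \<and> (\<forall>u\<in>verts G. \<forall>v\<in>verts G. \<exists>p. path_between G u v p)
     \<and> (\<nexists>p. is_path G p \<and> 3 \<le> length p \<and> {last p, hd p} \<in> edges G)"

definition degree :: "'v graph \<Rightarrow> 'v \<Rightarrow> nat" where
  "degree G v = card {e \<in> edges G. v \<in> e}"

definition leaves :: "'v graph \<Rightarrow> 'v set" where
  "leaves G = {v \<in> verts G. degree G v = 1}"

definition subtree :: "'v graph \<Rightarrow> 'v graph \<Rightarrow> bool" where
  "subtree H G \<longleftrightarrow> tree H \<and> verts H \<subseteq> verts G \<and> edges H \<subseteq> edges G"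

definition tree_dist :: "'v graph \<Rightarrow> ('v set \<Rightarrow> real) \<Rightarrow> 'v \<Rightarrow> 'v \<Rightarrow> real" where
  "tree_dist T w u v = sum w (path_edges (THE p. path_between T u v p))"


section \<open>Cherries\<close>

text \<open>The two leaves of a 2-cherry are required to be leaves of the ambient tree; otherwise
  any path of length two around a vertex of degree at least three would qualify.
  Bivalence refers to the degree in the ambient tree.\<close>

definition two_cherry :: "'v graph \<Rightarrow> 'v \<Rightarrow> 'v graph \<Rightarrow> bool" where
  "two_cherry T s B \<longleftrightarrow> subtree B T \<and> card (leaves B) = 2 \<and> leaves B \<subseteq> leaves T
     \<and> {v \<in> verts B - leaves B. degree T v \<noteq> 2} = {s}"

definition neighbours :: "'v graph \<Rightarrow> 'v \<Rightarrow> 'v \<Rightarrow> bool" where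
  "neighbours T a b \<longleftrightarrow> (\<exists>s B. two_cherry T s B \<and> leaves B = {a, b})"

definition cherry :: "'v graph \<Rightarrow> 'v graph \<Rightarrow> bool" where
  "cherry T C \<longleftrightarrow> (\<exists>s \<B>. \<B> \<noteq> {} \<and> (\<forall>B\<in>\<B>. two_cherry T s B)
     \<and> C = (\<Union>B\<in>\<B>. verts B, \<Union>B\<in>\<B>. edges B))"


section \<open>Weighted trees with labelled leaves\<close>

text \<open>A twig runs from a leaf to the first vertex of degree at least three; an edge is internal
  if it lies on no twig.\<close>

definition twig :: "'v graph \<Rightarrow> 'v list \<Rightarrow> bool" where
  "twig T p \<longleftrightarrow> is_path T p \<and> hd p \<in> leaves T \<and> 3 \<le> degree T (last p)
     \<and> (\<forall>v\<in>set (butlast p). degree T v \<le> 2)"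

definition internal_edge :: "'v graph \<Rightarrow> 'v set \<Rightarrow> bool" where
  "internal_edge T e \<longleftrightarrow> e \<in> edges T \<and> (\<forall>p. twig T p \<longrightarrow> e \<notin> path_edges p)"

text \<open>The labelling \<open>lf\<close> names the leaves \<open>1, \<dots>, n\<close>.\<close>

definition leaf_labelled_tree :: "'v graph \<Rightarrow> nat \<Rightarrow> (nat \<Rightarrow> 'v) \<Rightarrow> bool" where
  "leaf_labelled_tree T n lf \<longleftrightarrow> tree T \<and> bij_betw lf {1..n} (leaves T)"

text \<open>Positivity of the internal weights cannot be dropped below, whereas the weights on twigs may
  be arbitrary reals: if the quartet tree with cherries \<open>{1,2}\<close> and \<open>{3,4}\<close> has
  internal weight \<open>-1\<close>, then every column minimum of \<open>S\<close> is attained across the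
  internal edge and no cherry is found; if that weight is \<open>0\<close>, all off-diagonal entries of
  \<open>S\<close> are equal and the non-neighbours \<open>1\<close> and \<open>3\<close> pass the test.\<close>

definition internally_positive :: "'v graph \<Rightarrow> ('v set \<Rightarrow> real) \<Rightarrow> bool" where
  "internally_positive T w \<longleftrightarrow> (\<forall>e. internal_edge T e \<longrightarrow> 0 < w e)"

definition leaf_dist ::
  "'v graph \<Rightarrow> ('v set \<Rightarrow> real) \<Rightarrow> (nat \<Rightarrow> 'v) \<Rightarrow> nat \<Rightarrow> nat \<Rightarrow> real" where
  "leaf_dist T w lf i j = tree_dist T w (lf i) (lf j)"


section \<open>The matrix S and the selected couples\<close>

definition S :: "nat \<Rightarrow> (nat \<Rightarrow> nat \<Rightarrow> real) \<Rightarrow> nat \<Rightarrow> nat \<Rightarrow> real" where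
  "S n D i j = (real n - 2) * D i j - (\<Sum>k\<in>{1..n} - {i}. D i k) - (\<Sum>k\<in>{1..n} - {j}. D j k)"

definition column_min :: "nat \<Rightarrow> (nat \<Rightarrow> nat \<Rightarrow> real) \<Rightarrow> nat \<Rightarrow> real" where
  "column_min n D j = Min ((\<lambda>i. S n D i j) ` ({1..n} - {j}))"

definition partner :: "nat \<Rightarrow> (nat \<Rightarrow> nat \<Rightarrow> real) \<Rightarrow> nat \<Rightarrow> nat" where
  "partner n D j = Min {i \<in> {1..n} - {j}. S n D i j = column_min n D j}"

definition kept :: "nat \<Rightarrow> (nat \<Rightarrow> nat \<Rightarrow> real) \<Rightarrow> nat \<Rightarrow> bool" where
  "kept n D j \<longleftrightarrow>
     (\<exists>c. \<forall>k\<in>{1..n} - {j, partner n D j}. D k (partner n D j) - D k j = c)"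

definition kept_couples :: "nat \<Rightarrow> (nat \<Rightarrow> nat \<Rightarrow> real) \<Rightarrow> (nat \<times> nat) set" where
  "kept_couples n D = {(partner n D j, j) | j. j \<in> {1..n} \<and> kept n D j}"


section \<open>Counting elementary operations\<close>

text \<open>A uniform unit-cost machine over the reals. Programs have real arrays, arrays of indices, and
  index variables set only by bounded loops (so that every program terminates). Indices can be
  copied and compared, but there is no index arithmetic and no rounding. Every constant, every
  read, every write, every arithmetic operation, every comparison, every connective, every branch
  and every loop iteration costs one.\<close>

record store =
  nvar :: "string \<Rightarrow> nat"
  narr :: "string \<Rightarrow> nat \<Rightarrow> nat"
  rarr :: "string \<Rightarrow> nat \<Rightarrow> nat \<Rightarrow> real"

datatype nexp = NConst nat | NVar string | NArr string nexp

datatype rexp = RNat nexp | RArr string nexp nexp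
  | RAdd rexp rexp | RSub rexp rexp | RMul rexp rexp | RDiv rexp rexp

datatype bexp = NEq nexp nexp | NLess nexp nexp | REq rexp rexp | RLess rexp rexp
  | BNot bexp | BAnd bexp bexp

datatype cmd = Skip
  | NSet string nexp nexp
  | RSet string nexp nexp rexp
  | Seq cmd cmd
  | Cond bexp cmd cmd
  | For string nexp cmd

primrec nval :: "nexp \<Rightarrow> store \<Rightarrow> nat" where
  "nval (NConst c) s = c"
| "nval (NVar x) s = nvar s x"
| "nval (NArr a e) s = narr s a (nval e s)"

primrec rval :: "rexp \<Rightarrow> store \<Rightarrow> real" where
  "rval (RNat e) s = real (nval e s)"
| "rval (RArr a e f) s = rarr s a (nval e s) (nval f s)"
| "rval (RAdd p q) s = rval p s + rval q s"
| "rval (RSub p q) s = rval p s - rval q s"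
| "rval (RMul p q) s = rval p s * rval q s"
| "rval (RDiv p q) s = rval p s / rval q s"

primrec bval :: "bexp \<Rightarrow> store \<Rightarrow> bool" where
  "bval (NEq e f) s \<longleftrightarrow> nval e s = nval f s"
| "bval (NLess e f) s \<longleftrightarrow> nval e s < nval f s"
| "bval (REq p q) s \<longleftrightarrow> rval p s = rval q s"
| "bval (RLess p q) s \<longleftrightarrow> rval p s < rval q s"
| "bval (BNot b) s \<longleftrightarrow> \<not> bval b s"
| "bval (BAnd b c) s \<longleftrightarrow> bval b s \<and> bval c s"

primrec ncost :: "nexp \<Rightarrow> nat" where
  "ncost (NConst c) = 1"
| "ncost (NVar x) = 1"
| "ncost (NArr a e) = 1 + ncost e"

primrec rcost :: "rexp \<Rightarrow> nat" where
  "rcost (RNat e) = 1 + ncost e"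
| "rcost (RArr a e f) = 1 + ncost e + ncost f"
| "rcost (RAdd p q) = 1 + rcost p + rcost q"
| "rcost (RSub p q) = 1 + rcost p + rcost q"
| "rcost (RMul p q) = 1 + rcost p + rcost q"
| "rcost (RDiv p q) = 1 + rcost p + rcost q"

primrec bcost :: "bexp \<Rightarrow> nat" where
  "bcost (NEq e f) = 1 + ncost e + ncost f"
| "bcost (NLess e f) = 1 + ncost e + ncost f"
| "bcost (REq p q) = 1 + rcost p + rcost q"
| "bcost (RLess p q) = 1 + rcost p + rcost q"
| "bcost (BNot b) = 1 + bcost b"
| "bcost (BAnd b c) = 1 + bcost b + bcost c"

text \<open>\<open>run c s\<close> is the final store together with the number of elementary operations.
  The body of \<open>For x e c\<close> is run with \<open>x = 1, \<dots>, m\<close>, where \<open>m\<close> is the value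
  of \<open>e\<close> on entry.\<close>

primrec run :: "cmd \<Rightarrow> store \<Rightarrow> store \<times> nat" where
  "run Skip = (\<lambda>s. (s, 1))"
| "run (NSet a i e) = (\<lambda>s.
     (s\<lparr>narr := (narr s)(a := (narr s a)(nval i s := nval e s))\<rparr>, 1 + ncost i + ncost e))"
| "run (RSet a i j p) = (\<lambda>s.
     (s\<lparr>rarr := (rarr s)(a := (rarr s a)(nval i s := (rarr s a (nval i s))(nval j s := rval p s)))\<rparr>,
      1 + ncost i + ncost j + rcost p))"
| "run (Seq c d) = (\<lambda>s.
     let (s', t) = run c s; (s'', t') = run d s' in (s'', t + t'))"
| "run (Cond b c d) = (\<lambda>s.
     let (s', t) = (if bval b s then run c s else run d s) in (s', 1 + bcost b + t))"
| "run (For x e c) = (\<lambda>s.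
     fold (\<lambda>i (s, t). let (s', t') = run c (s\<lparr>nvar := (nvar s)(x := i)\<rparr>) in (s', t + 1 + t'))
       [1..<Suc (nval e s)] (s, 1 + ncost e))"

abbreviation final :: "cmd \<Rightarrow> store \<Rightarrow> store" where "final c s \<equiv> fst (run c s)"
abbreviation operations :: "cmd \<Rightarrow> store \<Rightarrow> nat" where "operations c s \<equiv> snd (run c s)"

text \<open>The number \<open>n\<close> and the entries of \<open>D\<close> are given; all other cells are arbitrary.\<close>

definition input :: "nat \<Rightarrow> (nat \<Rightarrow> nat \<Rightarrow> real) \<Rightarrow> store \<Rightarrow> bool" where
  "input n D s \<longleftrightarrow> nvar s ''n'' = n \<and> (\<forall>i\<in>{1..n}. \<forall>j\<in>{1..n}. rarr s ''D'' i j = D i j)"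

end

(*
  Removing an edge e cuts the leaves in two, and D_{i,j} is the sum of the weights of the edges
  separating i and j.  Hence S_{i,j} is -2 times the sum of c_e(i,j) w(e), where c_e(i,j) = 1 if e
  separates i and j, and otherwise c_e(i,j) is the number of leaves on the side containing neither.
  An edge of a twig always has factor 1, whereas an internal edge leaves at least two leaves on
  either side; so, internal weights being positive, whenever j has a neighbour its column is
  minimal exactly at its neighbours, which are the leaves joined to j by a path without internal
  edges.  Conversely, if some internal edge separates i and j, a leaf on the side of i and a leaf
  on the side of j show that the columns i and j do not differ by a constant, because two distinct
  edges always cut the leaves compatibly.  Since i_j is the smallest neighbour of j, the number
  min(j, i_j) names the cherry of j.
*)
theory Submission
  imports Defs "HOL-Library.Sublist"
begin

section \<open>Paths in trees\<close>

text \<open>Seen from a fixed vertex \<open>r\<close>, an edge is a Boolean function on the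
  vertices: whether the path from \<open>r\<close> crosses it. By \<open>sep_cut\<close>, the edge
  lies on the path from \<open>u\<close> to \<open>v\<close> exactly if its values at
  \<open>u\<close> and \<open>v\<close> differ. This turns transitivity of being joined without
  internal edges, which is awkward for 2-cherries as subgraphs, into transitivity of equality, and
  it lets the argument about columns run in \<open>split_system\<close>, where no tree occurs any
  more. Three leaves are required because a tree with two leaves is a path: it has no vertex of
  degree three, hence neither twigs nor stalks. If \<open>j\<close> has no neighbour, nothing is
  claimed about where its column is minimal; its couple is rejected by the difference test
  alone.\<close>

lemma path_edges_Nil [simp]: "path_edges [] = {}"
  and path_edges_single [simp]: "path_edges [u] = {}"
  and path_edges_Cons [simp]: "path_edges (u # v # p) = insert {u, v} (path_edges (v # p))"
  by (auto simp: path_edges_def)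

lemma path_edges_subset: "e \<in> path_edges p \<Longrightarrow> e \<subseteq> set p"
  by (induction p rule: induct_list012) auto

lemma path_edges_append: "path_edges (p @ x # q) = path_edges (p @ [x]) \<union> path_edges (x # q)"
  by (induction p rule: induct_list012) auto

lemma path_edges_rev [simp]: "path_edges (rev p) = path_edges p"
proof (induction p rule: induct_list012)
  case (3 x y zs)
  have "path_edges (rev zs @ [y, x]) = path_edges (rev zs @ [y]) \<union> path_edges [y, x]"
    by (rule path_edges_append)
  with 3 show ?case by (auto simp: insert_commute)
qed auto

lemma path_edgesE:
  assumes "e \<in> path_edges p"
  obtains p1 u v p2 where "p = p1 @ u # v # p2" "e = {u, v}"
proof -
  have "\<exists>p1 u v p2. p = p1 @ u # v # p2 \<and> e = {u, v}"
    using assms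
  proof (induction p rule: induct_list012)
    case (3 x y zs)
    show ?case
    proof (cases "e = {x, y}")
      case True then show ?thesis by (metis append_Nil)
    next
      case False
      with 3 obtain p1 u v p2 where "y # zs = p1 @ u # v # p2" "e = {u, v}" by auto
      then have "x # y # zs = (x # p1) @ u # v # p2" by simp
      then show ?thesis using \<open>e = {u, v}\<close> by blast
    qed
  qed auto
  then show thesis using that by blast
qed

lemma path_edges_mid: "{u, v} \<in> path_edges (p1 @ u # v # p2)"
  by (subst path_edges_append) simp

lemma successively_edges_iff: "successively (\<lambda>u v. {u, v} \<in> E) p \<longleftrightarrow> path_edges p \<subseteq> E"
  by (induction p rule: induct_list012) auto

lemma is_path_iff:
  "is_path G p \<longleftrightarrow> p \<noteq> [] \<and> distinct p \<and> set p \<subseteq> verts G \<and> path_edges p \<subseteq> edges G"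
  by (simp add: is_path_def successively_edges_iff)

lemma is_path_rev [simp]: "is_path G (rev p) \<longleftrightarrow> is_path G p"
  by (simp add: is_path_iff)

lemma is_path_appendD1: "is_path G (p @ q) \<Longrightarrow> p \<noteq> [] \<Longrightarrow> is_path G p"
  and is_path_appendD2: "is_path G (p @ q) \<Longrightarrow> q \<noteq> [] \<Longrightarrow> is_path G q"
  by (auto simp: is_path_def successively_append_iff)

lemma path_between_rev: "path_between G u v p \<Longrightarrow> path_between G v u (rev p)"
  by (auto simp: path_between_def hd_rev last_rev)

lemma is_path_append_edge:
  assumes "is_path G p" "is_path G q" "set p \<inter> set q = {}" "{last p, hd q} \<in> edges G"
  shows "is_path G (p @ q)"
  using assms by (auto simp: is_path_def successively_append_iff)

lemma is_path_glue:
  assumes "is_path G (p @ [x])" "is_path G (x # q)" "set p \<inter> set q = {}"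
  shows "is_path G (p @ x # q)"
  using assms by (auto simp: is_path_iff path_edges_append[of p x q])

locale tree_graph =
  fixes G :: "'v graph"
  assumes tree_G: "tree G"
begin

lemma edgeD: assumes "{u, v} \<in> edges G" shows "u \<noteq> v" "u \<in> verts G" "v \<in> verts G"
proof -
  have "{u, v} \<subseteq> verts G" "card {u, v} = 2"
    using tree_G assms by (auto simp: tree_def simple_graph_def)
  then show "u \<noteq> v" "u \<in> verts G" "v \<in> verts G" by auto
qed

lemma edge_cases: assumes "e \<in> edges G" obtains u v where "e = {u, v}" "u \<noteq> v"
proof -
  have "card e = 2" using tree_G assms by (auto simp: tree_def simple_graph_def)
  then show thesis using that by (auto simp: card_2_iff)
qed

lemma finite_verts: "finite (verts G)"
  using tree_G by (simp add: tree_def simple_graph_def)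

lemma finite_edges: "finite (edges G)"
proof (rule finite_subset)
  show "edges G \<subseteq> Pow (verts G)" using tree_G by (auto simp: tree_def simple_graph_def)
qed (simp add: finite_verts)

lemma no_cycle: "is_path G p \<Longrightarrow> 3 \<le> length p \<Longrightarrow> {last p, hd p} \<notin> edges G"
  using tree_G by (auto simp: tree_def)

text \<open>If the second vertices differ, the first vertex of \<open>p'\<close> that lies on
  \<open>q'\<close> closes a cycle through \<open>u\<close>; otherwise the common first vertex is
  dropped.\<close>

lemma path_unique_aux:
  "is_path G p \<Longrightarrow> is_path G q \<Longrightarrow> hd p = hd q \<Longrightarrow> last p = last q \<Longrightarrow> p = q"
proof (induction p arbitrary: q)
  case Nil then show ?case by (simp add: is_path_iff)
next
  case (Cons u p')
  from Cons.prems obtain q' where q: "q = u # q'" by (cases q) (auto simp: is_path_iff)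
  show ?case
  proof (cases "p' = [] \<or> q' = []")
    case True
    with Cons.prems q show ?thesis by (auto simp: is_path_iff split: if_splits)
  next
    case False
    then have ne: "p' \<noteq> []" "q' \<noteq> []" by auto
    have pp: "is_path G p'" "is_path G q'"
      using is_path_appendD2[of G "[u]"] Cons.prems(1,2) q ne by auto
    have lst: "last p' = last q'" using Cons.prems(4) q ne by simp
    show ?thesis
    proof (cases "hd p' = hd q'")
      case True with Cons.IH[OF pp] lst q show ?thesis by simp
    next
      case False
      have "\<exists>x\<in>set p'. x \<in> set q'" using lst last_in_set[OF ne(1)] last_in_set[OF ne(2)] by metis
      then obtain p1 z p2 where p1: "p' = p1 @ z # p2" "z \<in> set q'" "\<forall>y\<in>set p1. y \<notin> set q'"
        using split_list_first_prop[of p' "\<lambda>x. x \<in> set q'"] by blast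
      from p1(2) obtain q1 q2 where q1: "q' = q1 @ z # q2" by (metis split_list)
      have a: "is_path G (u # p1 @ [z])"
        using is_path_appendD1[of G "u # p1 @ [z]" p2] Cons.prems(1) p1 by simp
      have b: "is_path G (z # rev q1)"
      proof -
        have "is_path G (q1 @ [z])" using is_path_appendD1[of G "q1 @ [z]" q2] pp q1 by simp
        then have "is_path G (rev (q1 @ [z]))" by (simp only: is_path_rev)
        then show ?thesis by simp
      qed
      have "u \<notin> set q'" using Cons.prems(2) q by (simp add: is_path_iff)
      then have "is_path G ((u # p1) @ z # rev q1)"
        using is_path_glue[of G "u # p1" z "rev q1"] a b p1(3) q1 by auto
      \<comment> \<open>\<open>p1\<close> and \<open>q1\<close> are not both empty, for then
        \<open>z\<close> would be the head of both \<open>p'\<close> and \<open>q'\<close>.\<close>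
      moreover have "3 \<le> length ((u # p1) @ z # rev q1)"
        using False p1 q1 by (cases p1; cases q1) auto
      moreover have "last ((u # p1) @ z # rev q1) = hd q'"
        using q1 by (cases q1) auto
      moreover have "{hd q', u} \<in> edges G"
        using Cons.prems(2) q ne by (cases q') (auto simp: is_path_iff insert_commute)
      ultimately show ?thesis using no_cycle by fastforce
    qed
  qed
qed

lemma path_unique: "path_between G u v p \<Longrightarrow> path_between G u v q \<Longrightarrow> p = q"
  by (auto simp: path_between_def intro: path_unique_aux)

definition P :: "'v \<Rightarrow> 'v \<Rightarrow> 'v list" where "P u v = (THE p. path_between G u v p)"

lemma P_eq: "path_between G u v p \<Longrightarrow> P u v = p"
  unfolding P_def by (rule the_equality) (auto intro: path_unique)

lemma path_between_P: assumes "u \<in> verts G" "v \<in> verts G" shows "path_between G u v (P u v)"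
proof -
  obtain p where "path_between G u v p" using tree_G assms unfolding tree_def by blast
  then show ?thesis using P_eq[of u v p] by simp
qed

lemma P_rev: assumes "u \<in> verts G" "v \<in> verts G" shows "P v u = rev (P u v)"
  by (rule P_eq[OF path_between_rev[OF path_between_P[OF assms]]])

text \<open>In a tree an edge lies on the path between two vertices exactly if deleting it separates
  them, so path membership stands for separation and no components have to be formed.\<close>

abbreviation sep :: "'v set \<Rightarrow> 'v \<Rightarrow> 'v \<Rightarrow> bool" where "sep e u v \<equiv> e \<in> path_edges (P u v)"

lemma P_same: assumes "u \<in> verts G" shows "P u u = [u]"
  by (rule P_eq) (use assms in \<open>simp add: path_between_def is_path_iff\<close>)

lemma P_edge: assumes "{u, v} \<in> edges G" shows "P u v = [u, v]"
  by (rule P_eq) (use assms edgeD[OF assms] in \<open>simp add: path_between_def is_path_iff\<close>)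

lemma sep_in_edges: assumes "u \<in> verts G" "v \<in> verts G" "sep e u v" shows "e \<in> edges G"
  using path_between_P[OF assms(1,2)] assms(3) by (auto simp: path_between_def is_path_iff)

lemma sep_sym: assumes "u \<in> verts G" "v \<in> verts G" shows "sep e u v \<longleftrightarrow> sep e v u"
  using P_rev[OF assms] by simp

lemma P_split:
  assumes "u \<in> verts G" "v \<in> verts G" "P u v = p @ x # q"
  shows "P u x = p @ [x]" "P x v = x # q"
proof -
  have pb: "path_between G u v (p @ x # q)" using path_between_P[OF assms(1,2)] assms(3) by simp
  then have "is_path G (p @ [x])" "is_path G (x # q)"
    using is_path_appendD1[of G "p @ [x]" q] is_path_appendD2[of G p] by (auto simp: path_between_def)
  moreover have "hd (p @ [x]) = u" "last (x # q) = v" using pb by (cases p; auto simp: path_between_def)+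
  ultimately show "P u x = p @ [x]" "P x v = x # q" by (auto intro!: P_eq simp: path_between_def)
qed

text \<open>Moving the end along an edge toggles exactly that edge. Either \<open>v\<close> is new,
  and the path to \<open>u\<close> extends by \<open>v\<close>; or \<open>v\<close> already lies on
  that path, whose rest from \<open>v\<close> to \<open>u\<close> must be the edge itself, so the
  path to \<open>u\<close> extends the one to \<open>v\<close>.\<close>

lemma sep_step:
  assumes r: "r \<in> verts G" and e: "{u, v} \<in> edges G"
  shows "sep f r v \<longleftrightarrow> (sep f r u \<noteq> (f = {u, v}))"
proof -
  note uv = edgeD[OF e]
  have *: "sep f r b \<longleftrightarrow> (sep f r a \<noteq> (f = {a, b}))"
    if "{a, b} \<in> edges G" "b \<notin> set (P r a)" for a b
  proof -
    note ab = edgeD[OF that(1)]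
    have pa: "path_between G r a (P r a)" using r ab path_between_P by blast
    have "is_path G (P r a @ [b])"
      using pa that ab by (intro is_path_append_edge) (auto simp: path_between_def is_path_iff)
    then have eq: "P r b = P r a @ [b]"
      using pa by (intro P_eq) (auto simp: path_between_def is_path_iff)
    obtain p where p: "P r a = p @ [a]" using pa unfolding path_between_def is_path_iff
      by (metis append_butlast_last_id)
    have "path_edges (P r b) = path_edges (P r a) \<union> {{a, b}}"
      using eq p path_edges_append[of p a "[b]"] by simp
    moreover have "{a, b} \<notin> path_edges (P r a)" using that path_edges_subset by fast
    ultimately show ?thesis by auto
  qed
  show ?thesis
  proof (cases "v \<in> set (P r u)")
    case False then show ?thesis using * e by blast
  next
    case True
    then obtain p q where pq: "P r u = p @ v # q" by (metis split_list)
    have "P v u = v # q" using P_split[OF r uv(2) pq] by simp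
    moreover have "P v u = [v, u]" using P_edge[of v u] e by (simp add: insert_commute)
    ultimately have "q = [u]" by simp
    moreover have "distinct (P r u)" using path_between_P[OF r uv(2)] by (simp add: path_between_def is_path_iff)
    ultimately have "u \<notin> set (p @ [v])" using pq by auto
    then have "u \<notin> set (P r v)" using P_split[OF r uv(2) pq] by simp
    then show ?thesis using *[of v u] e by (auto simp: insert_commute)
  qed
qed

text \<open>A path uses an edge at most once, so along it the status of \<open>f\<close> toggles
  once if \<open>f\<close> is used and never otherwise.\<close>

lemma sep_cut_path:
  assumes "r \<in> verts G" "is_path G p"
  shows "f \<in> path_edges p \<longleftrightarrow> sep f r (hd p) \<noteq> sep f r (last p)"
  using assms(2)
proof (induction p rule: induct_list012)
  case (3 x y zs)
  have e: "{x, y} \<in> edges G" and yp: "is_path G (y # zs)"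
    using 3(3) is_path_appendD2[of G "[x]" "y # zs"] by (auto simp: is_path_iff)
  have "{x, y} \<notin> path_edges (y # zs)"
    using 3(3) path_edges_subset[of "{x, y}" "y # zs"] by (auto simp: is_path_iff)
  with 3(2)[OF yp] sep_step[OF assms(1) e, of f] show ?case by auto
qed (auto simp: is_path_iff)

lemma sep_cut:
  assumes "r \<in> verts G" "u \<in> verts G" "v \<in> verts G"
  shows "sep f u v \<longleftrightarrow> sep f r u \<noteq> sep f r v"
  using path_between_P[OF assms(2,3)] sep_cut_path[OF assms(1)] by (auto simp: path_between_def)

end

section \<open>Leaves and twigs\<close>

context tree_graph
begin

lemma finite_incident: "finite {e \<in> edges G. v \<in> e}"
  using finite_edges by simp

lemma leaf_in_verts: "a \<in> leaves G \<Longrightarrow> a \<in> verts G"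
  and leaf_degree: "a \<in> leaves G \<Longrightarrow> degree G a = 1"
  by (auto simp: leaves_def)

lemma finite_leaves: "finite (leaves G)"
  using finite_verts by (simp add: leaves_def)

lemma degree_ge2I:
  assumes "{v, a} \<in> edges G" "{v, b} \<in> edges G" "a \<noteq> b"
  shows "2 \<le> degree G v"
proof -
  have "card {{v, a}, {v, b}} \<le> degree G v"
    unfolding degree_def by (rule card_mono[OF finite_incident]) (use assms in auto)
  moreover have "{v, a} \<noteq> {v, b}" using assms(3) by (auto simp: doubleton_eq_iff)
  ultimately show ?thesis by simp
qed

lemma degree_ge3I:
  assumes "{v, a} \<in> edges G" "{v, b} \<in> edges G" "{v, c} \<in> edges G" "a \<noteq> b" "a \<noteq> c" "b \<noteq> c"
  shows "3 \<le> degree G v"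
proof -
  have "card {{v, a}, {v, b}, {v, c}} \<le> degree G v"
    unfolding degree_def by (rule card_mono[OF finite_incident]) (use assms in auto)
  moreover have "{v, a} \<noteq> {v, b}" "{v, a} \<noteq> {v, c}" "{v, b} \<noteq> {v, c}"
    using assms(4-6) by (auto simp: doubleton_eq_iff)
  ultimately show ?thesis by simp
qed

lemma other_neighbour:
  assumes "finite A" "card A < degree G v"
  obtains z where "{v, z} \<in> edges G" "z \<notin> A"
proof -
  have "\<exists>z. {v, z} \<in> edges G \<and> z \<notin> A"
  proof (rule ccontr)
    assume *: "\<not> ?thesis"
    have "{e \<in> edges G. v \<in> e} \<subseteq> (\<lambda>z. {v, z}) ` A"
    proof
      fix e assume e: "e \<in> {e \<in> edges G. v \<in> e}"
      then obtain x y where "e = {x, y}" using edge_cases by blast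
      with e obtain z where "e = {v, z}" by (auto simp: insert_commute)
      with e * show "e \<in> (\<lambda>z. {v, z}) ` A" by auto
    qed
    then have "degree G v \<le> card ((\<lambda>z. {v, z}) ` A)"
      unfolding degree_def using assms(1) by (intro card_mono) auto
    also have "\<dots> \<le> card A" using assms(1) by (rule card_image_le)
    finally show False using assms(2) by simp
  qed
  then show thesis using that by blast
qed

lemma path_step:
  assumes "is_path G (p @ u # v # q)"
  shows "{u, v} \<in> edges G" "{v, u} \<in> edges G"
  using assms by (auto simp: is_path_def successively_append_iff insert_commute)

lemma path_interior_degree:
  assumes "is_path G (p @ u # v # x # q)"
  shows "2 \<le> degree G v"
proof (rule degree_ge2I)
  show "{v, u} \<in> edges G" using path_step(2) assms .
  show "{v, x} \<in> edges G" using path_step(1)[of "p @ [u]" v x q] assms by simp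
  show "u \<noteq> x" using assms by (auto simp: is_path_def)
qed

lemma path_vertex_cases:
  assumes "v \<in> set p"
  obtains "v = hd p" | "v = last p" | p1 u x p2 where "p = p1 @ u # v # x # p2"
proof -
  obtain a b where ab: "p = a @ v # b" using assms by (metis split_list)
  show thesis
  proof (cases "a = [] \<or> b = []")
    case True with ab that show thesis by auto
  next
    case False
    then have "p = butlast a @ last a # v # hd b # tl b" using ab by simp
    then show thesis using that(3) by blast
  qed
qed

lemma leaf_on_path:
  assumes "is_path G p" "v \<in> set p" "v \<in> leaves G"
  shows "v = hd p \<or> v = last p"
  using assms(2)
proof (cases rule: path_vertex_cases)
  case (3 p1 u x p2)
  then show ?thesis using path_interior_degree[of p1 u v x p2] assms leaf_degree by fastforce
qed auto

text \<open>A repetition of \<open>z\<close> would close a cycle; it has at least three vertices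
  because \<open>z\<close> is not the predecessor \<open>u\<close>.\<close>

lemma path_snoc:
  assumes "is_path G (p @ [u, v])" "{v, z} \<in> edges G" "z \<noteq> u"
  shows "is_path G (p @ [u, v, z])"
proof -
  have "z \<notin> set (p @ [u, v])"
  proof
    assume "z \<in> set (p @ [u, v])"
    then have "z \<in> set p" using assms edgeD(1)[OF assms(2)] by auto
    then obtain a b where p: "p = a @ z # b" by (metis split_list)
    have "is_path G (z # b @ [u, v])" using is_path_appendD2[of G a] assms(1) p by simp
    then show False using no_cycle[of "z # b @ [u, v]"] assms(2) by simp
  qed
  moreover have "is_path G [z]" using edgeD[OF assms(2)] by (simp add: is_path_def)
  ultimately show ?thesis
    using is_path_append_edge[OF assms(1), of "[z]"] assms(2) by simp
qed

text \<open>As long as the end is no leaf, it has a neighbour other than its predecessor, and the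
  path grows; the number of vertices bounds its length. Two initial vertices ensure that there is a
  predecessor.\<close>

lemma extend_to_leaf:
  assumes "is_path G p" "2 \<le> length p"
  obtains q where "is_path G (p @ q)" "last (p @ q) \<in> leaves G"
proof -
  have "\<exists>q. is_path G (p @ q) \<and> last (p @ q) \<in> leaves G"
    using assms
  proof (induction "card (verts G) - length p" arbitrary: p rule: less_induct)
    case less
    obtain p' v where "p = p' @ [v]" using less.prems(2) by (cases p rule: rev_cases) auto
    moreover obtain p0 u where "p' = p0 @ [u]"
      using less.prems(2) \<open>p = p' @ [v]\<close> by (cases p' rule: rev_cases) auto
    ultimately have p: "p = p0 @ [u, v]" by simp
    have uv: "{v, u} \<in> edges G" using path_step(2)[of p0 u v "[]"] less.prems(1) p by simp
    show ?case
    proof (cases "v \<in> leaves G")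
      case True then show ?thesis using p less.prems by (intro exI[of _ "[]"]) simp
    next
      case False
      have "{v, u} \<in> {e \<in> edges G. v \<in> e}" using uv by simp
      then have "degree G v \<noteq> 0" unfolding degree_def using finite_incident by (metis card_0_eq empty_iff)
      then have "card {u} < degree G v" using False edgeD[OF uv] by (auto simp: leaves_def)
      then obtain z where z: "{v, z} \<in> edges G" "z \<notin> {u}" using other_neighbour by blast
      then have path: "is_path G (p @ [z])" using path_snoc[of p0 u v z] p less.prems by simp
      then have "length (p @ [z]) \<le> card (verts G)"
        using card_mono[OF finite_verts] distinct_card unfolding is_path_def by metis
      then obtain q where "is_path G ((p @ [z]) @ q)" "last ((p @ [z]) @ q) \<in> leaves G"
        using less.hyps[of "p @ [z]"] path less.prems(2) by fastforce
      then show ?thesis by (intro exI[of _ "z # q"]) simp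
    qed
  qed
  then show thesis using that by blast
qed

lemma leaf_unique_neighbour:
  assumes "a \<in> leaves G" "{a, x} \<in> edges G" "{a, y} \<in> edges G"
  shows "x = y"
  using degree_ge2I[OF assms(2,3)] leaf_degree[OF assms(1)] by fastforce

text \<open>Where the two paths part, the vertex has too many neighbours: two if it is the leaf
  \<open>hd t\<close>, three if it is a later vertex, which still lies in \<open>butlast t\<close>.
  If instead \<open>q\<close> ends inside \<open>t\<close>, its final leaf must be the end of
  \<open>t\<close>, whose degree is at least three.\<close>

lemma twig_prefix:
  assumes t: "twig G t" and q: "is_path G q" "hd q = hd t" "last q \<in> leaves G" "last q \<noteq> hd t"
  shows "prefix t q"
proof (rule ccontr)
  assume n: "\<not> prefix t q"
  have t': "is_path G t" "hd t \<in> leaves G" "3 \<le> degree G (last t)"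
    "\<And>v. v \<in> set (butlast t) \<Longrightarrow> degree G v \<le> 2"
    using t by (auto simp: twig_def)
  have ne: "t \<noteq> []" "q \<noteq> []" using t'(1) q(1) by (auto simp: is_path_def)
  show False
  proof (cases "prefix q t")
    case True
    then have "last q \<in> set t" using ne set_mono_prefix last_in_set by fastforce
    then have "last q = last t" using leaf_on_path[OF t'(1) _ q(3)] q(4) by auto
    then show False using t'(3) leaf_degree[OF q(3)] by simp
  next
    case False
    then obtain as b bs c cs where
      d: "b \<noteq> c" "t = as @ b # bs" "q = as @ c # cs"
      using parallel_decomp[of t q] n by (auto simp: parallel_def)
    have "as \<noteq> []" using d q(2) by (cases as) auto
    then obtain as' v where as: "as = as' @ [v]" by (metis append_butlast_last_id)
    have bc: "{v, b} \<in> edges G" "{v, c} \<in> edges G"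
      using path_step(1)[of as' v b bs] path_step(1)[of as' v c cs] t' q d as by auto
    show False
    proof (cases as' rule: rev_cases)
      case Nil
      then have "v = hd t" using d as by simp
      then show False using leaf_unique_neighbour[of v b c] bc t' d by simp
    next
      case (snoc as'' u)
      have "{v, u} \<in> edges G" using path_step(2)[of as'' u v "b # bs"] t'(1) d as snoc by simp
      moreover have "u \<noteq> b" "u \<noteq> c" using t'(1) q(1) d as snoc by (auto simp: is_path_def)
      ultimately have "3 \<le> degree G v" using degree_ge3I[of v u b c] bc d by blast
      moreover have "v \<in> set (butlast t)" using d as by (auto simp: butlast_append)
      ultimately show False using t'(4) by fastforce
    qed
  qed
qed

lemma twig_sep:
  assumes t: "twig G t" and e: "e \<in> path_edges t" and k: "k \<in> leaves G" "k \<noteq> hd t"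
  shows "sep e (hd t) k"
proof -
  have "hd t \<in> leaves G" using t by (simp add: twig_def)
  then have "path_between G (hd t) k (P (hd t) k)"
    using path_between_P leaf_in_verts k by blast
  then have "prefix t (P (hd t) k)" using twig_prefix[OF t] k by (auto simp: path_between_def)
  then obtain s where "P (hd t) k = t @ s" by (auto simp: prefix_def)
  moreover obtain p1 u v p2 where "t = p1 @ u # v # p2" "e = {u, v}" using e by (rule path_edgesE)
  ultimately show ?thesis using path_edges_mid[of u v p1 "p2 @ s"] by simp
qed

lemma pendant_edge:
  assumes "e \<in> edges G" "\<not> internal_edge G e"
  obtains l where "l \<in> leaves G" "\<And>k. k \<in> leaves G \<Longrightarrow> k \<noteq> l \<Longrightarrow> sep e l k"
proof -
  obtain t where t: "twig G t" "e \<in> path_edges t" using assms by (auto simp: internal_edge_def)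
  then have "hd t \<in> leaves G" by (simp add: twig_def)
  then show thesis using that twig_sep[OF t] by blast
qed

text \<open>The path from a third leaf \<open>c\<close> to \<open>a\<close> meets the path from
  \<open>a\<close> to \<open>b\<close> for the first time in some \<open>z\<close>; there it arrives
  from a neighbour \<open>y\<close> off the path.\<close>

lemma branch_vertex:
  assumes n: "3 \<le> card (leaves G)" and ab: "a \<in> leaves G" "b \<in> leaves G" "a \<noteq> b"
  obtains v where "v \<in> set (P a b)" "3 \<le> degree G v"
proof -
  have "card {a, b} < card (leaves G)" using n ab by simp
  then have "\<not> leaves G \<subseteq> {a, b}" using card_mono[of "{a, b}" "leaves G"] by auto
  then obtain c where c: "c \<in> leaves G" "c \<noteq> a" "c \<noteq> b" by auto
  define p where "p = P a b"
  define q where "q = P c a"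
  have p: "is_path G p" "hd p = a" "last p = b"
    using path_between_P[of a b] ab leaf_in_verts by (auto simp: path_between_def p_def)
  have q: "is_path G q" "hd q = c" "last q = a"
    using path_between_P[of c a] ab c leaf_in_verts by (auto simp: path_between_def q_def)
  have "p \<noteq> []" "q \<noteq> []" using p q by (auto simp: is_path_def)
  then have "a \<in> set p" "a \<in> set q" using p(2) q(3) hd_in_set[of p] last_in_set[of q] by auto
  then obtain q1 z q2 where z: "q = q1 @ z # q2" "z \<in> set p" "\<forall>y\<in>set q1. y \<notin> set p"
    using split_list_first_prop[of q "\<lambda>x. x \<in> set p"] by auto
  have "c \<notin> set p" using leaf_on_path[OF p(1) _ c(1)] c p by auto
  then have "q1 \<noteq> []" using z q by auto
  then obtain q0 y where y: "q1 = q0 @ [y]" by (metis append_butlast_last_id)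
  have zy: "{z, y} \<in> edges G" using path_step(2)[of q0 y z q2] q z y by simp
  have yp: "y \<notin> set p" using z y by simp
  \<comment> \<open>Excludes that \<open>z\<close> is \<open>a\<close> or \<open>b\<close>: an end
    of \<open>p\<close> has a neighbour on \<open>p\<close>, and \<open>y\<close> would be a second
    one.\<close>
  have nl: "z \<notin> leaves G" if "{z, w} \<in> edges G" "w \<in> set p" for w
    using leaf_unique_neighbour[of z w y] that yp zy by auto
  have "3 \<le> degree G z"
    using z(2)
  proof (cases rule: path_vertex_cases)
    case 1
    obtain p' w where "p = a # w # p'" using p ab by (cases p; cases "tl p") (auto simp: is_path_def)
    then show ?thesis using nl[of w] path_step(1)[of "[]" a w p'] p 1 ab by auto
  next
    case 2
    then have "rev p \<noteq> []" "hd (rev p) = b" "last (rev p) = a" using p by (auto simp: is_path_def hd_rev last_rev)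
    then obtain p' w where "rev p = b # w # p'" using ab by (cases "rev p"; cases "tl (rev p)") auto
    then have "p = rev p' @ w # b # []" by (metis rev_swap rev.simps(2) append.assoc append_Cons append_Nil)
    then show ?thesis using nl[of w] path_step(2)[of "rev p'" w b "[]"] p 2 ab by auto
  next
    case (3 p1 u x p2)
    have "{z, u} \<in> edges G" using path_step(2)[of p1 u z "x # p2"] p 3 by simp
    moreover have "{z, x} \<in> edges G" using path_step(1)[of "p1 @ [u]" z x p2] p 3 by simp
    moreover have "u \<noteq> x" "u \<noteq> y" "x \<noteq> y" using 3 yp p by (auto simp: is_path_def)
    ultimately show ?thesis using degree_ge3I zy by blast
  qed
  then show thesis using that z(2) p_def by blast
qed

lemma twig_exists:
  assumes n: "3 \<le> card (leaves G)" and a: "a \<in> leaves G"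
  obtains t where "twig G t" "hd t = a"
proof -
  have "\<not> leaves G \<subseteq> {a}" using n card_mono[of "{a}" "leaves G"] by auto
  then obtain b where b: "b \<in> leaves G" "a \<noteq> b" by auto
  obtain v where v: "v \<in> set (P a b)" "3 \<le> degree G v" using branch_vertex[OF n a b] by blast
  have p: "is_path G (P a b)" "hd (P a b) = a"
    using path_between_P[of a b] a b leaf_in_verts by (auto simp: path_between_def)
  obtain p1 z p2 where z: "P a b = p1 @ z # p2" "3 \<le> degree G z" "\<forall>y\<in>set p1. \<not> 3 \<le> degree G y"
    using split_list_first_prop[of "P a b" "\<lambda>x. 3 \<le> degree G x"] v by auto
  have "hd (p1 @ [z]) = a" using p z by (cases p1) auto
  moreover have "is_path G (p1 @ [z])" using is_path_appendD1[of G "p1 @ [z]" p2] p z by simp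
  ultimately have "twig G (p1 @ [z])" using z a by (auto simp: twig_def)
  then show thesis using that \<open>hd (p1 @ [z]) = a\<close> by blast
qed

lemma path_start_not_sep:
  assumes "is_path G (y # x # q)"
  shows "\<not> sep {x, y} x (last (x # q))"
proof -
  have "is_path G (x # q)" using is_path_appendD2[of G "[y]" "x # q"] assms by simp
  then have "P x (last (x # q)) = x # q" by (intro P_eq) (simp add: path_between_def)
  moreover have "y \<notin> set (x # q)" using assms by (simp add: is_path_def)
  ultimately show ?thesis using path_edges_subset by (metis insert_subset)
qed

text \<open>A branch vertex \<open>z\<close> on a path that leaves \<open>y\<close> through
  \<open>x\<close> and ends in a leaf has a neighbour besides its two neighbours on the path. Going
  on from there yields a second leaf, and neither path returns to the edge.\<close>

lemma internal_edge_two_leaves: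
  assumes n: "3 \<le> card (leaves G)" and e: "internal_edge G {x, y}"
  obtains l l' where "l \<in> leaves G" "l' \<in> leaves G" "l \<noteq> l'"
    "\<not> sep {x, y} x l" "\<not> sep {x, y} x l'"
proof -
  have xy: "{x, y} \<in> edges G" using e by (simp add: internal_edge_def)
  have yx: "is_path G [y, x]" using edgeD[OF xy] xy by (auto simp: is_path_def insert_commute)
  then obtain q where q: "is_path G (y # x # q)" "last (x # q) \<in> leaves G"
    using extend_to_leaf[of "[y, x]"] by auto
  \<comment> \<open>Otherwise the path is continued backwards past \<open>y\<close> to another leaf.
    The whole path has a branch vertex, necessarily at \<open>y\<close> or later, and its piece up
    to the first one is a twig through the edge, which is then not internal.\<close>
  have "\<exists>z\<in>set (x # q). 3 \<le> degree G z"
  proof (rule ccontr)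
    assume low: "\<not> ?thesis"
    have "is_path G (rev (y # x # q))" using q(1) by (simp only: is_path_rev)
    then obtain q' where q': "is_path G (rev (y # x # q) @ q')" "last (rev (y # x # q) @ q') \<in> leaves G"
      using extend_to_leaf[of "rev (y # x # q)"] by auto
    define r where "r = rev (y # x # q) @ q'"
    define l where "l = last (x # q)"
    have hdr: "hd r = l" by (simp add: r_def l_def hd_append hd_rev)
    have r: "is_path G r" "last r \<in> leaves G" using q' by (auto simp: r_def)
    have lr: "l \<noteq> last r"
    proof -
      have "2 \<le> length r" by (simp add: r_def)
      then have "\<exists>a b c. r = a # b # c" by (cases r; cases "tl r") auto
      then obtain a b c where abc: "r = a # b # c" by blast
      then have "last r \<in> set (b # c)" using abc last_in_set[of "b # c"] by simp
      then show ?thesis using r hdr abc by (auto simp: is_path_def)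
    qed
    have "P l (last r) = r" by (rule P_eq) (use r hdr in \<open>simp add: path_between_def\<close>)
    then obtain v where v: "v \<in> set r" "3 \<le> degree G v"
      using branch_vertex[OF n, of l "last r"] lr q(2) r(2) l_def by auto
    then have "v \<in> set (y # q')" using low by (auto simp: r_def)
    then obtain s1 z s2 where z: "y # q' = s1 @ z # s2" "3 \<le> degree G z" "\<forall>v\<in>set s1. \<not> 3 \<le> degree G v"
      using split_list_first_prop[of "y # q'" "\<lambda>v. 3 \<le> degree G v"] v by auto
    have rz: "r = (rev (x # q) @ s1 @ [z]) @ s2" using z by (simp add: r_def)
    define t where "t = rev (x # q) @ s1 @ [z]"
    have "is_path G t" using is_path_appendD1[of G t s2] r rz by (simp add: t_def)
    moreover have "hd t = l" by (simp add: t_def l_def hd_append hd_rev)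
    moreover have "last t = z" "butlast t = rev (x # q) @ s1" by (auto simp: t_def butlast_append)
    ultimately have "twig G t" using z low q(2) by (auto simp: twig_def l_def)
    moreover have "{x, y} \<in> path_edges t"
    proof -
      have "\<exists>s. s1 @ [z] = y # s" using z(1) by (cases s1) auto
      then obtain s where "t = rev q @ x # y # s" by (auto simp: t_def)
      then show ?thesis using path_edges_mid by metis
    qed
    ultimately show False using e by (auto simp: internal_edge_def)
  qed
  then obtain z where z: "z \<in> set (x # q)" "3 \<le> degree G z" by blast
  then obtain m1 m2 where m: "x # q = m1 @ z # m2" by (metis split_list)
  have "z \<noteq> last (x # q)" using z q leaf_degree[of z] by auto
  then have "m2 \<noteq> []" using m by auto
  \<comment> \<open>The predecessor of \<open>z\<close>, which is \<open>y\<close> when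
    \<open>z = x\<close>.\<close>
  define u where "u = last (y # m1)"
  define m0 where "m0 = butlast (y # m1)"
  have um: "y # m1 = m0 @ [u]" unfolding u_def m0_def by (rule append_butlast_last_id[symmetric]) simp
  have "card {u, hd m2} < degree G z" using z(2) card_insert_le_m1[of 2 "{hd m2}" u] by simp
  then obtain z' where z': "{z, z'} \<in> edges G" "z' \<noteq> u" "z' \<noteq> hd m2"
    using other_neighbour[of "{u, hd m2}" z] by auto
  have full: "y # x # q = m0 @ [u, z] @ m2" using m um by (metis append.assoc append_Cons append_Nil)
  have "is_path G (m0 @ [u, z])" using is_path_appendD1[of G "m0 @ [u, z]" m2] q(1) full by simp
  then have "is_path G (m0 @ [u, z, z'])" using path_snoc z' by blast
  then obtain q' where q': "is_path G ((m0 @ [u, z, z']) @ q')" "last ((m0 @ [u, z, z']) @ q') \<in> leaves G"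
    using extend_to_leaf[of "m0 @ [u, z, z']"] by auto
  have "\<exists>s. m1 @ [z] = x # s" using m by (cases m1) auto
  then obtain s where s: "m1 @ [z] = x # s" by blast
  define qq where "qq = s @ z' # q'"
  have eqq: "(m0 @ [u, z, z']) @ q' = y # x # qq"
  proof -
    have "(m0 @ [u, z, z']) @ q' = y # (m1 @ [z]) @ z' # q'" using um by (metis append.assoc append_Cons append_Nil)
    then show ?thesis using s by (simp add: qq_def)
  qed
  have "last (x # q) \<noteq> last (x # qq)"
  proof
    assume "last (x # q) = last (x # qq)"
    then have "y # x # q = y # x # qq"
      using q(1) q'(1) eqq by (intro path_unique_aux) auto
    then have "m0 @ [u, z] @ m2 = m0 @ [u, z, z'] @ q'" using full eqq by simp
    then show False using z'(3) by auto
  qed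
  moreover have "last (x # qq) \<in> leaves G" using q'(2) unfolding eqq by simp
  ultimately show thesis
    using that[of "last (x # q)" "last (x # qq)"] q path_start_not_sep[OF q(1)]
      path_start_not_sep[of y x qq] q'(1) eqq by simp
qed

text \<open>Of the four intersections of sides of two distinct edges, one is empty: the part of the tree
  beyond \<open>e\<close> as seen from \<open>f\<close> does not meet the part beyond \<open>f\<close> as seen from \<open>e\<close>.\<close>

lemma sep_compat:
  assumes ef: "{x, y} \<noteq> {c, d}" "{x, y} \<in> edges G" "{c, d} \<in> edges G" and v: "v \<in> verts G"
    and "sep {x, y} v c" "sep {c, d} v x"
  shows False
proof -
  note xy = edgeD[OF ef(2)] and cd = edgeD[OF ef(3)]
  \<comment> \<open>With \<open>v\<close> on the side of \<open>x\<close>, the path from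
    \<open>v\<close> to \<open>x\<close> runs through \<open>c\<close>, so its part from
    \<open>v\<close> to \<open>c\<close> avoids \<open>{x, y}\<close>.\<close>
  have main: False if h: "{x, y} \<noteq> {c, d}" "{x, y} \<in> edges G" "{c, d} \<in> edges G"
    "sep {x, y} v c" "sep {c, d} v x" "\<not> sep {x, y} v x" for x y
  proof -
    note xy = edgeD[OF h(2)]
    have "c \<in> set (P v x)" using h(5) path_edges_subset by fast
    then obtain p q where pq: "P v x = p @ c # q" by (metis split_list)
    have "path_edges (P v x) = path_edges (P v c) \<union> path_edges (c # q)"
      using P_split(1)[OF v xy(2) pq] pq path_edges_append[of p c q] by simp
    then show False using h(4,6) by auto
  qed
  show False
  proof (cases "sep {x, y} v x")
    case False then show False using main assms by blast
  next
    case True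
    have "\<not> sep {x, y} v y"
      using sep_step[OF v, of x y "{x, y}"] True ef(2) by simp
    \<comment> \<open>Now \<open>v\<close> is on the side of \<open>y\<close>. Being a different
      edge, \<open>{c, d}\<close> separates \<open>v\<close> from \<open>y\<close> just as from
      \<open>x\<close>, so \<open>main\<close> applies with \<open>x\<close> and \<open>y\<close>
      exchanged.\<close>
    moreover have "sep {c, d} v y" using sep_step[OF v ef(2), of "{c, d}"] assms(6) ef(1) by auto
    ultimately show False using main[of y x] assms by (simp add: insert_commute)
  qed
qed

end

section \<open>Cherries and internal edges\<close>

lemma is_path_mono:
  "is_path H p \<Longrightarrow> verts H \<subseteq> verts G \<Longrightarrow> edges H \<subseteq> edges G \<Longrightarrow> is_path G p"
  unfolding is_path_iff by blast

lemma path_between_sublist: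
  assumes "is_path G (a @ u # b)" "v \<in> set (u # b)"
  shows "\<exists>q. path_between G u v q"
proof -
  obtain c d where cd: "u # b = c @ v # d" using assms(2) by (metis split_list)
  have "is_path G (u # b)" using assms(1) is_path_appendD2[of G a] by simp
  then have "is_path G (c @ [v])" using cd is_path_appendD1[of G "c @ [v]" d] by simp
  moreover have "hd (c @ [v]) = u" using cd by (cases c) auto
  ultimately show ?thesis by (auto simp: path_between_def)
qed

context tree_graph
begin

lemma degree_mono: "edges H \<subseteq> edges G \<Longrightarrow> degree H v \<le> degree G v"
  unfolding degree_def by (rule card_mono[OF finite_incident]) auto

lemma degree_pos:
  assumes "u \<in> verts G" "v \<in> verts G" "u \<noteq> v"
  shows "1 \<le> degree G u"
proof -
  have p: "is_path G (P u v)" "hd (P u v) = u" "last (P u v) = v"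
    using path_between_P[of u v] assms by (auto simp: path_between_def)
  obtain w q where "P u v = u # w # q"
    using p assms(3) by (cases "P u v"; cases "tl (P u v)") (auto simp: is_path_def)
  then have "{u, w} \<in> {e \<in> edges G. u \<in> e}" using path_step(1)[of "[]" u w q] p by simp
  then have "card {e \<in> edges G. u \<in> e} \<noteq> 0" using finite_incident by (metis card_0_eq empty_iff)
  then show ?thesis by (simp add: degree_def)
qed

text \<open>Acyclicity is inherited from \<open>G\<close>, and two vertices are joined by a segment
  of \<open>p\<close> or its reversal. Such graphs serve as 2-cherries below.\<close>

lemma tree_path_graph:
  assumes p: "is_path G p"
  shows "tree (set p, path_edges p)"
proof -
  let ?H = "(set p, path_edges p)"
  have sub: "verts ?H \<subseteq> verts G" "edges ?H \<subseteq> edges G" using p by (auto simp: is_path_iff)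
  have Hp: "is_path ?H p" using p by (auto simp: is_path_iff)
  have "e \<subseteq> set p \<and> card e = 2" if "e \<in> path_edges p" for e
    using that path_edges_subset[OF that] sub tree_G by (auto simp: tree_def simple_graph_def)
  then have "simple_graph ?H" by (simp add: simple_graph_def)
  moreover have "\<exists>q. path_between ?H u v q" if uv: "u \<in> set p" "v \<in> set p" for u v
  proof -
    obtain a b where ab: "p = a @ u # b" using uv by (metis split_list)
    show ?thesis
    proof (cases "v \<in> set (u # b)")
      case True then show ?thesis using path_between_sublist[of ?H a u b v] Hp ab by simp
    next
      case False
      then have "v \<in> set a" using uv ab by auto
      then obtain c d where "a = c @ v # d" by (metis split_list)
      then obtain q where "path_between ?H v u q"
        using path_between_sublist[of ?H c v "d @ u # b" u] Hp ab by auto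
      then show ?thesis using path_between_rev[of ?H v u q] by blast
    qed
  qed
  moreover have "{last q, hd q} \<notin> edges ?H" if "is_path ?H q" "3 \<le> length q" for q
    using no_cycle[OF is_path_mono[OF that(1) sub] that(2)] sub by blast
  moreover have "set p \<noteq> {}" using p by (simp add: is_path_def)
  ultimately show ?thesis unfolding tree_def by auto
qed

lemma leaves_path_graph:
  assumes p: "is_path G p" and "hd p \<in> leaves G" "last p \<in> leaves G" "hd p \<noteq> last p"
  shows "leaves (set p, path_edges p) = {hd p, last p}"
proof -
  let ?H = "(set p, path_edges p)"
  interpret H: tree_graph ?H using tree_path_graph[OF p] by unfold_locales
  have Hp: "is_path ?H p" using p by (auto simp: is_path_iff)
  have sub: "edges ?H \<subseteq> edges G" using p by (auto simp: is_path_iff)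
  have ends: "hd p \<in> set p" "last p \<in> set p" using p by (auto simp: is_path_def)
  have "degree ?H (hd p) = 1" "degree ?H (last p) = 1"
    using degree_mono[OF sub, of "hd p"] degree_mono[OF sub, of "last p"] leaf_degree assms(2-4)
      H.degree_pos[of "hd p" "last p"] H.degree_pos[of "last p" "hd p"] ends by fastforce+
  then show ?thesis
    using ends H.leaf_on_path[OF Hp] by (auto simp: leaves_def)
qed

text \<open>Two leaves turn out to be neighbours iff they are distinct and \<open>linked\<close>; unlike the
  existence of a 2-cherry, this condition is visibly transitive, by \<open>sep_cut\<close>.\<close>

definition linked :: "'v \<Rightarrow> 'v \<Rightarrow> bool" where
  "linked u v \<longleftrightarrow> (\<forall>e. internal_edge G e \<longrightarrow> \<not> sep e u v)"

lemma linked_sym: "u \<in> verts G \<Longrightarrow> v \<in> verts G \<Longrightarrow> linked u v \<Longrightarrow> linked v u"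
  using sep_sym[of u v] by (simp add: linked_def)

lemma linked_trans:
  "u \<in> verts G \<Longrightarrow> v \<in> verts G \<Longrightarrow> x \<in> verts G \<Longrightarrow> linked u v \<Longrightarrow> linked v x \<Longrightarrow> linked u x"
  using sep_cut[of v u x] sep_sym[of u v] by (simp add: linked_def)

text \<open>Let \<open>x\<close> be the first branch vertex seen from \<open>a\<close>. The edge by
  which the path leaves \<open>x\<close> is not internal, so it lies on a twig, and this twig can
  only come from \<open>b\<close>; hence no later vertex branches.\<close>

lemma branch_vertex_unique:
  assumes ab: "a \<in> leaves G" "b \<in> leaves G" and link: "linked a b"
    and z: "z \<in> set (P a b)" "3 \<le> degree G z" and z': "z' \<in> set (P a b)" "3 \<le> degree G z'"
  shows "z = z'"
proof -
  have V: "a \<in> verts G" "b \<in> verts G" using ab leaf_in_verts by auto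
  have p: "is_path G (P a b)" "hd (P a b) = a" "last (P a b) = b"
    using path_between_P[OF V] by (auto simp: path_between_def)
  obtain p1 x p2 where x: "P a b = p1 @ x # p2" "3 \<le> degree G x" "\<forall>y\<in>set p1. \<not> 3 \<le> degree G y"
    using split_list_first_prop[of "P a b" "\<lambda>v. 3 \<le> degree G v"] z by auto
  have "x \<noteq> b" using x(2) leaf_degree[OF ab(2)] by auto
  then obtain y p3 where y: "p2 = y # p3" using p(3) x(1) by (cases p2) auto
  let ?e = "{x, y}"
  have sep: "sep ?e a b" using x y path_edges_mid[of x y p1 p3] by simp
  then have "a \<noteq> b" using P_same[OF V(1)] by auto
  have "?e \<in> edges G" "\<not> internal_edge G ?e"
    using sep link sep_in_edges[OF V] by (auto simp: linked_def)
  then obtain t where t: "twig G t" "?e \<in> path_edges t" by (auto simp: internal_edge_def)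
  then have et: "{x, y} \<subseteq> set t" using path_edges_subset by blast
  have ht: "hd t \<in> leaves G" using t by (simp add: twig_def)
  have low: "degree G v \<le> 2" if "v \<in> set (butlast t)" for v using t that by (simp add: twig_def)
  have dist: "distinct (P a b)" using p by (simp add: is_path_def)
  \<comment> \<open>A twig from \<open>a\<close> would have \<open>x\<close> before its end, against
    the degree of \<open>x\<close>. A twig from a third leaf cuts that leaf off from both
    \<open>a\<close> and \<open>b\<close>, so its edges do not separate \<open>a\<close> from
    \<open>b\<close>.\<close>
  consider "hd t = a" | "hd t \<noteq> a" "hd t = b" | "hd t \<noteq> a" "hd t \<noteq> b" by blast
  then have "\<forall>v\<in>set p2. degree G v \<le> 2"
  proof cases
    case 1
    then have "prefix t (P a b)" using twig_prefix[OF t(1) p(1)] p ab \<open>a \<noteq> b\<close> by simp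
    then have "prefix t ((p1 @ [x]) @ p2)" using x(1) by simp
    moreover have "\<not> prefix t (p1 @ [x])"
      using et dist x y set_mono_prefix[of t "p1 @ [x]"] by auto
    ultimately obtain us where "t = (p1 @ [x]) @ us" "us \<noteq> []"
      using prefix_append[of t "p1 @ [x]" p2] by (metis append_Nil2 prefix_order.refl)
    then have "x \<in> set (butlast t)" by (simp add: butlast_append)
    then show ?thesis using low x(2) by fastforce
  next
    case 2
    have P': "P b a = rev p2 @ x # rev p1" using P_rev[OF V] x by simp
    have "is_path G (P b a)" "hd (P b a) = b" "last (P b a) = a"
      using path_between_P[OF V(2,1)] by (auto simp: path_between_def)
    then have "prefix t (rev p2 @ x # rev p1)"
      using twig_prefix[OF t(1), of "P b a"] 2 ab P' by auto
    moreover have "\<not> prefix t (rev p2)"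
      using et dist x set_mono_prefix[of t "rev p2"] by auto
    ultimately obtain us where "t = rev p2 @ us" "us \<noteq> []"
      using prefix_append[of t "rev p2" "x # rev p1"] by (metis append_Nil2 prefix_order.refl)
    then show ?thesis using low by (simp add: butlast_append)
  next
    case 3
    then have "sep ?e (hd t) a" "sep ?e (hd t) b" using twig_sep[OF t] ab by auto
    then show ?thesis using sep sep_cut[of "hd t" a b] V ht leaf_in_verts by blast
  qed
  then have "v = x" if "v \<in> set (P a b)" "3 \<le> degree G v" for v using that x by fastforce
  then show ?thesis using z z' by metis
qed

text \<open>The path of \<open>B\<close> between its leaves is \<open>P a b\<close>, and a vertex of
  degree at least three on it can only be \<open>s\<close>. Cut at \<open>s\<close>, the path falls
  into two twigs, which contain no internal edge.\<close>

lemma two_cherryD: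
  assumes n: "3 \<le> card (leaves G)" and B: "two_cherry G s B" "leaves B = {a, b}"
  shows "a \<noteq> b" "a \<in> leaves G" "b \<in> leaves G" "s \<in> set (P a b)" "3 \<le> degree G s" "linked a b"
proof -
  have H: "tree B" "verts B \<subseteq> verts G" "edges B \<subseteq> edges G" "card {a, b} = 2"
    "{a, b} \<subseteq> leaves G" "{v \<in> verts B - {a, b}. degree G v \<noteq> 2} = {s}"
    using B by (auto simp: two_cherry_def subtree_def)
  show ab: "a \<noteq> b" "a \<in> leaves G" "b \<in> leaves G" using H by auto
  then have V: "a \<in> verts G" "b \<in> verts G" using leaf_in_verts by auto
  have "a \<in> verts B" "b \<in> verts B" using B(2) by (auto simp: leaves_def)
  then obtain p where pB: "path_between B a b p" using H(1) unfolding tree_def by blast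
  then have "path_between G a b p" using is_path_mono[OF _ H(2,3)] by (auto simp: path_between_def)
  then have Pp: "P a b = p" and p: "is_path G p" "hd p = a" "last p = b"
    using P_eq by (auto simp: path_between_def)
  have pv: "set p \<subseteq> verts B" using pB by (simp add: path_between_def is_path_def)
  obtain v where v: "v \<in> set (P a b)" "3 \<le> degree G v" using branch_vertex[OF n ab(2,3,1)] by blast
  then have "v \<in> {v \<in> verts B - {a, b}. degree G v \<noteq> 2}"
    using pv Pp leaf_degree[of v] ab by auto
  then have "v = s" using H(6) by blast
  with v show s: "s \<in> set (P a b)" "3 \<le> degree G s" by auto
  have low: "degree G v \<le> 2" if "v \<in> set p" "v \<noteq> s" for v
  proof (cases "v \<in> {a, b}")
    case True then show ?thesis using leaf_degree[of v] ab by auto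
  next
    case False
    then have "v \<in> verts B - {a, b}" using that pv by auto
    moreover have "v \<notin> {v \<in> verts B - {a, b}. degree G v \<noteq> 2}" using H(6) that(2) by simp
    ultimately show ?thesis by auto
  qed
  obtain p1 p2 where p12: "p = p1 @ s # p2" using s(1) Pp by (metis split_list)
  have dist: "s \<notin> set p1" "s \<notin> set p2" using p p12 by (auto simp: is_path_def)
  have t1: "twig G (p1 @ [s])"
  proof -
    have "is_path G (p1 @ [s])" using p p12 is_path_appendD1[of G "p1 @ [s]" p2] by simp
    moreover have "hd (p1 @ [s]) = a" using p p12 by (cases p1) auto
    ultimately show ?thesis using low s dist ab p12 by (auto simp: twig_def)
  qed
  have t2: "twig G (rev p2 @ [s])"
  proof -
    have "is_path G (s # p2)" using p p12 is_path_appendD2[of G p1] by simp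
    then have "is_path G (rev (s # p2))" by (simp only: is_path_rev)
    moreover have "hd (rev p2 @ [s]) = b" using p p12 by (cases p2 rule: rev_cases) auto
    ultimately show ?thesis using low s dist ab p12 by (auto simp: twig_def)
  qed
  show "linked a b"
    unfolding linked_def
  proof (intro allI impI)
    fix e assume e: "internal_edge G e"
    have "path_edges p = path_edges (p1 @ [s]) \<union> path_edges (rev (s # p2))"
      using p12 path_edges_append[of p1 s p2] path_edges_rev[of "s # p2"] by simp
    then show "\<not> sep e a b" using Pp e t1 t2 by (auto simp: internal_edge_def)
  qed
qed

text \<open>The stalk is described as the end of the twig from \<open>a\<close>, without reference
  to \<open>b\<close>: so all 2-cherries obtained here for the same \<open>a\<close> have a common
  stalk and can be united to a cherry.\<close>

lemma two_cherryI:
  assumes ab: "a \<in> leaves G" "b \<in> leaves G" "a \<noteq> b" "linked a b"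
    and t: "twig G t" "hd t = a"
  shows "two_cherry G (last t) (set (P a b), path_edges (P a b))"
    and "leaves (set (P a b), path_edges (P a b)) = {a, b}"
proof -
  let ?H = "(set (P a b), path_edges (P a b))"
  have V: "a \<in> verts G" "b \<in> verts G" using ab leaf_in_verts by auto
  have p: "is_path G (P a b)" "hd (P a b) = a" "last (P a b) = b"
    using path_between_P[OF V] by (auto simp: path_between_def)
  show lv: "leaves ?H = {a, b}" using leaves_path_graph[OF p(1)] p ab by simp
  have "prefix t (P a b)" using twig_prefix[OF t(1) p(1)] p ab t by auto
  moreover have "t \<noteq> []" using t by (auto simp: twig_def is_path_def)
  ultimately have lt: "last t \<in> set (P a b)" using set_mono_prefix last_in_set by fastforce
  have d3: "3 \<le> degree G (last t)" using t by (simp add: twig_def)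
  have mid: "v = last t" if v: "v \<in> set (P a b)" "v \<notin> {a, b}" "degree G v \<noteq> 2" for v
  proof -
    have "2 \<le> degree G v" using v(1)
    proof (cases rule: path_vertex_cases)
      case (3 p1 u x p2)
      then show ?thesis using path_interior_degree[of p1 u v x p2] p(1) by simp
    qed (use v p in auto)
    then show ?thesis using branch_vertex_unique[OF ab(1,2,4) v(1) _ lt d3] v(3) by simp
  qed
  have stalk: "last t \<notin> {a, b}" using leaf_degree[of "last t"] ab d3 by auto
  have "{v \<in> verts ?H - leaves ?H. degree G v \<noteq> 2} = {last t}"
    unfolding lv fst_conv
  proof (intro set_eqI iffI)
    fix v assume "v \<in> {v \<in> set (P a b) - {a, b}. degree G v \<noteq> 2}"
    then show "v \<in> {last t}" using mid by simp
  next
    fix v assume "v \<in> {last t}"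
    then show "v \<in> {v \<in> set (P a b) - {a, b}. degree G v \<noteq> 2}" using lt d3 stalk by simp
  qed
  then show "two_cherry G (last t) ?H"
    using lv ab p tree_path_graph[OF p(1)] by (auto simp: two_cherry_def subtree_def is_path_iff)
qed

lemma neighbours_iff_linked:
  assumes n: "3 \<le> card (leaves G)"
  shows "neighbours G a b \<longleftrightarrow> a \<in> leaves G \<and> b \<in> leaves G \<and> a \<noteq> b \<and> linked a b"
proof
  assume "neighbours G a b"
  then obtain s B where "two_cherry G s B" "leaves B = {a, b}" by (auto simp: neighbours_def)
  from two_cherryD[OF n this] show "a \<in> leaves G \<and> b \<in> leaves G \<and> a \<noteq> b \<and> linked a b"
    by simp
next
  assume *: "a \<in> leaves G \<and> b \<in> leaves G \<and> a \<noteq> b \<and> linked a b"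
  then obtain t where t: "twig G t" "hd t = a" using twig_exists[OF n, of a] by blast
  then have "two_cherry G (last t) (set (P a b), path_edges (P a b))"
    "leaves (set (P a b), path_edges (P a b)) = {a, b}" using two_cherryI[of a b t] * by blast+
  then show "neighbours G a b" unfolding neighbours_def by blast
qed

text \<open>Two leaves of a cherry may come from different 2-cherries; both are linked to the common
  stalk, and \<open>linked_trans\<close> then links them.\<close>

lemma linked_stalk:
  assumes n: "3 \<le> card (leaves G)" and B: "two_cherry G s B" and a: "a \<in> leaves B"
  shows "a \<in> leaves G" "s \<in> verts G" "linked a s"
proof -
  have "card (leaves B) = 2" using B by (simp add: two_cherry_def)
  then obtain x y where "leaves B = {x, y}" by (auto simp: card_2_iff)
  then have "leaves B = {a, if a = x then y else x}" using a by auto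
  then obtain b where b: "leaves B = {a, b}" by blast
  note D = two_cherryD[OF n B b]
  show "a \<in> leaves G" by (rule D)
  have V: "a \<in> verts G" "b \<in> verts G" using D leaf_in_verts by auto
  obtain p1 p2 where p12: "P a b = p1 @ s # p2" using D(4) by (metis split_list)
  have "is_path G (P a b)" using path_between_P[OF V] by (simp add: path_between_def)
  then show "s \<in> verts G" using D(4) by (auto simp: is_path_def)
  show "linked a s"
    using D(6) P_split(1)[OF V p12] p12 path_edges_append[of p1 s p2] by (auto simp: linked_def)
qed

text \<open>Being a leaf need not survive a union of graphs. Here the degrees are squeezed: every
  vertex of a member has degree at least one in it, and a leaf of a member is a leaf of
  \<open>G\<close>, so its degree in the union is at most one.\<close>

lemma leaves_Union_two_cherries:
  assumes n: "3 \<le> card (leaves G)" and B: "\<forall>B\<in>\<B>. two_cherry G s B"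
  shows "leaves (\<Union>B\<in>\<B>. verts B, \<Union>B\<in>\<B>. edges B) = (\<Union>B\<in>\<B>. leaves B)"
proof -
  let ?C = "(\<Union>B\<in>\<B>. verts B, \<Union>B\<in>\<B>. edges B)"
  have CG: "edges ?C \<subseteq> edges G" using B by (auto simp: two_cherry_def subtree_def)
  have pos: "1 \<le> degree B v" if "B \<in> \<B>" "v \<in> verts B" for B v
  proof -
    have tB: "tree B" "card (leaves B) = 2" using B that by (auto simp: two_cherry_def subtree_def)
    interpret B: tree_graph B using tB by unfold_locales
    obtain x y where "x \<in> leaves B" "y \<in> leaves B" "x \<noteq> y" using tB(2) by (auto simp: card_2_iff)
    then show ?thesis using B.degree_pos[of v] that B.leaf_in_verts by metis
  qed
  have mono: "degree B v \<le> degree ?C v" if "B \<in> \<B>" for B v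
    unfolding degree_def
    by (rule card_mono) (use that CG finite_edges in \<open>auto intro: finite_subset[of _ "edges G"]\<close>)
  show ?thesis
  proof (intro equalityI subsetI)
    fix v assume v: "v \<in> leaves ?C"
    then obtain B where "B \<in> \<B>" "v \<in> verts B" by (auto simp: leaves_def)
    then show "v \<in> (\<Union>B\<in>\<B>. leaves B)"
      using v pos[of B v] mono[of B v] by (force simp: leaves_def)
  next
    fix v assume "v \<in> (\<Union>B\<in>\<B>. leaves B)"
    then obtain B where vB: "B \<in> \<B>" "v \<in> leaves B" by blast
    then have "v \<in> leaves G" using linked_stalk(1)[OF n] B by blast
    then have "degree ?C v \<le> 1" using degree_mono[OF CG, of v] leaf_degree by simp
    moreover have "1 \<le> degree ?C v" using vB mono[of B v] by (simp add: leaves_def)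
    ultimately show "v \<in> leaves ?C" using vB by (auto simp: leaves_def)
  qed
qed

text \<open>Any nonempty union of 2-cherries with one stalk counts as a cherry, so all pairwise
  linked sets of at least two leaves occur, and not only the maximal ones.\<close>

lemma cherry_leaf_set_iff:
  assumes n: "3 \<le> card (leaves G)" and X: "X \<subseteq> leaves G"
  shows "(\<exists>C. cherry G C \<and> leaves C = X) \<longleftrightarrow> 2 \<le> card X \<and> (\<forall>a\<in>X. \<forall>b\<in>X. linked a b)"
proof
  assume "\<exists>C. cherry G C \<and> leaves C = X"
  then obtain s \<B> where B: "\<B> \<noteq> {}" "\<forall>B\<in>\<B>. two_cherry G s B"
    "leaves (\<Union>B\<in>\<B>. verts B, \<Union>B\<in>\<B>. edges B) = X" by (auto simp: cherry_def)
  have XU: "X = (\<Union>B\<in>\<B>. leaves B)" using leaves_Union_two_cherries[OF n B(2)] B(3) by simp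
  obtain B0 where "B0 \<in> \<B>" using B(1) by blast
  moreover from this have "card (leaves B0) = 2" using B(2) by (simp add: two_cherry_def)
  moreover have "finite X" using X finite_leaves finite_subset by blast
  ultimately have "2 \<le> card X" using XU card_mono[of X "leaves B0"] by auto
  moreover have "linked a b" if ab: "a \<in> X" "b \<in> X" for a b
  proof -
    have "\<exists>B\<in>\<B>. a \<in> leaves B" "\<exists>B\<in>\<B>. b \<in> leaves B" using ab XU by auto
    then have "linked a s" "linked b s" "s \<in> verts G" using linked_stalk[OF n] B(2) by blast+
    then show ?thesis using linked_trans[of a s b] linked_sym[of b s] ab X leaf_in_verts by blast
  qed
  ultimately show "2 \<le> card X \<and> (\<forall>a\<in>X. \<forall>b\<in>X. linked a b)" by blast
next
  assume *: "2 \<le> card X \<and> (\<forall>a\<in>X. \<forall>b\<in>X. linked a b)"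
  then obtain a where a: "a \<in> X" by (metis card.empty ex_in_conv not_numeral_le_zero)
  obtain t where t: "twig G t" "hd t = a" using twig_exists[OF n] a X by blast
  \<comment> \<open>A star of 2-cherries at the fixed leaf \<open>a\<close> suffices: they share the
    stalk \<open>last t\<close>, and their leaves exhaust \<open>X\<close>.\<close>
  define B where "B b = (set (P a b), path_edges (P a b))" for b
  have B: "two_cherry G (last t) (B b)" "leaves (B b) = {a, b}" if "b \<in> X - {a}" for b
    using two_cherryI[OF _ _ _ _ t, of b] that X a * unfolding B_def by blast+
  have "X - {a} \<noteq> {}"
  proof
    assume "X - {a} = {}"
    then have "X = {a}" using a by blast
    then show False using * by simp
  qed
  moreover define C where "C = (\<Union>H\<in>B ` (X - {a}). verts H, \<Union>H\<in>B ` (X - {a}). edges H)"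
  ultimately have "cherry G C"
    unfolding cherry_def using B(1) by (intro exI[of _ "last t"] exI[of _ "B ` (X - {a})"]) auto
  moreover have "leaves C = X"
  proof -
    have "leaves C = (\<Union>H\<in>B ` (X - {a}). leaves H)"
      unfolding C_def by (rule leaves_Union_two_cherries[OF n]) (use B(1) in blast)
    also have "\<dots> = (\<Union>b\<in>X - {a}. {a, b})" using B(2) by auto
    also have "\<dots> = X" using a \<open>X - {a} \<noteq> {}\<close> by auto
    finally show ?thesis .
  qed
  ultimately show "\<exists>C. cherry G C \<and> leaves C = X" by blast
qed

lemma leaves_cherry_subset:
  assumes n: "3 \<le> card (leaves G)" and "cherry G C"
  shows "leaves C \<subseteq> leaves G"
proof -
  obtain s \<B> where B: "\<forall>B\<in>\<B>. two_cherry G s B"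
    "C = (\<Union>B\<in>\<B>. verts B, \<Union>B\<in>\<B>. edges B)" using assms(2) by (auto simp: cherry_def)
  then have "leaves C = (\<Union>B\<in>\<B>. leaves B)" using leaves_Union_two_cherries[OF n] by blast
  then show ?thesis using B linked_stalk(1)[OF n] by blast
qed

text \<open>Inside a 2-cherry a leaf of \<open>G\<close> is neither the stalk, of degree at least
  three, nor bivalent, so it is one of the two leaves. This strengthens the claim on rejected
  couples from leaves of a cherry to its vertices.\<close>

lemma leaf_in_cherry:
  assumes n: "3 \<le> card (leaves G)" and C: "cherry G C" and a: "a \<in> verts C" "a \<in> leaves G"
  shows "a \<in> leaves C"
proof -
  obtain s \<B> where B: "\<forall>B\<in>\<B>. two_cherry G s B"
    "C = (\<Union>B\<in>\<B>. verts B, \<Union>B\<in>\<B>. edges B)" using C by (auto simp: cherry_def)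
  then obtain H where H: "H \<in> \<B>" "a \<in> verts H" using a(1) by auto
  have tH: "two_cherry G s H" using B H by blast
  obtain x y where xy: "leaves H = {x, y}" using tH by (auto simp: two_cherry_def card_2_iff)
  have "3 \<le> degree G s" using two_cherryD(5)[OF n tH xy] .
  then have "a \<noteq> s" using leaf_degree[OF a(2)] by auto
  then have "a \<notin> {v \<in> verts H - leaves H. degree G v \<noteq> 2}" using tH by (simp add: two_cherry_def)
  then have "a \<in> leaves H" using H leaf_degree[OF a(2)] by simp
  then show ?thesis using B H leaves_Union_two_cherries[OF n B(1)] by auto
qed

end

section \<open>Column minima for a compatible system of splits\<close>

text \<open>\<open>E\<close> stands for the edges, \<open>I\<close> for the internal ones.
  \<open>side e\<close> names the two sides of \<open>e\<close> by Booleans; the names are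
  arbitrary, and only whether two leaves get equal values matters. In \<open>compat\<close>,
  \<open>b\<close> and \<open>c\<close> pick the sides whose intersection is empty.\<close>

locale split_system =
  fixes n :: nat and E I :: "'e set" and w :: "'e \<Rightarrow> real" and side :: "'e \<Rightarrow> nat \<Rightarrow> bool"
    and D :: "nat \<Rightarrow> nat \<Rightarrow> real"
  assumes n: "3 \<le> n" and finE: "finite E" and IE: "I \<subseteq> E" and pos: "\<And>e. e \<in> I \<Longrightarrow> 0 < w e"
    and D: "\<And>i j. i \<in> {1..n} \<Longrightarrow> j \<in> {1..n} \<Longrightarrow> D i j = (\<Sum>e\<in>E. w e * of_bool (side e i \<noteq> side e j))"
    and pendant: "\<And>e. e \<in> E - I \<Longrightarrow> \<exists>l\<in>{1..n}. \<forall>k\<in>{1..n} - {l}. side e k \<noteq> side e l"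
    and big: "\<And>e b. e \<in> I \<Longrightarrow> 2 \<le> card {k \<in> {1..n}. side e k = b}"
    and compat: "\<And>e f. e \<in> I \<Longrightarrow> f \<in> I \<Longrightarrow> e \<noteq> f \<Longrightarrow>
      \<exists>b c. \<forall>k\<in>{1..n}. \<not> (side e k = b \<and> side f k = c)"
begin

definition rel :: "nat \<Rightarrow> nat \<Rightarrow> bool" where
  "rel i j \<longleftrightarrow> (\<forall>e\<in>I. side e i = side e j)"

lemma rel_refl [simp]: "rel i i" and rel_sym: "rel i j \<Longrightarrow> rel j i"
  and rel_trans: "rel i j \<Longrightarrow> rel j k \<Longrightarrow> rel i k"
  by (auto simp: rel_def)

definition opp :: "'e \<Rightarrow> nat \<Rightarrow> nat" where
  "opp e j = card {k \<in> {1..n}. side e k \<noteq> side e j}"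

text \<open>The coefficient \<open>c_e(i,j)\<close> of the overview. If \<open>e\<close> does not
  separate \<open>i\<close> from \<open>j\<close>, then \<open>opp e i\<close> and
  \<open>opp e j\<close> coincide, so the formula is symmetric.\<close>

definition weight_factor :: "'e \<Rightarrow> nat \<Rightarrow> nat \<Rightarrow> real" where
  "weight_factor e i j = (if side e i = side e j then real (opp e j) else 1)"

lemma sum_opp: "(\<Sum>k\<in>{1..n} - {i}. of_bool (side e i \<noteq> side e k)) = real (opp e i)"
proof -
  have "(\<Sum>k\<in>{1..n} - {i}. of_bool (side e i \<noteq> side e k)) =
      (\<Sum>k\<in>{k \<in> {1..n}. side e k \<noteq> side e i}. 1 :: real)"
    by (rule sum.mono_neutral_cong_right) auto
  then show ?thesis by (simp add: opp_def)
qed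

lemma opp_add:
  assumes "side e i \<noteq> side e j"
  shows "opp e i + opp e j = n"
proof -
  have "opp e i + opp e j =
      card ({k \<in> {1..n}. side e k \<noteq> side e i} \<union> {k \<in> {1..n}. side e k \<noteq> side e j})"
    unfolding opp_def by (rule card_Un_disjoint[symmetric]) (use assms in auto)
  also have "{k \<in> {1..n}. side e k \<noteq> side e i} \<union> {k \<in> {1..n}. side e k \<noteq> side e j} = {1..n}"
    using assms by auto
  finally show ?thesis by simp
qed

text \<open>Edge by edge: a separated pair gives \<open>(n - 2) - n = -2\<close>, since the two
  opposite sides make up all leaves; an unseparated pair gives \<open>-2\<close> times the size of
  the opposite side. The coefficient \<open>n - 2\<close> in \<open>S\<close> makes the first value
  independent of the split.\<close>

lemma S_eq:
  assumes ij: "i \<in> {1..n}" "j \<in> {1..n}"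
  shows "S n D i j = - 2 * (\<Sum>e\<in>E. w e * weight_factor e i j)"
proof -
  have row: "(\<Sum>k\<in>{1..n} - {i}. D i k) = (\<Sum>e\<in>E. w e * real (opp e i))" if "i \<in> {1..n}" for i
  proof -
    have "(\<Sum>k\<in>{1..n} - {i}. D i k) =
        (\<Sum>k\<in>{1..n} - {i}. \<Sum>e\<in>E. w e * of_bool (side e i \<noteq> side e k))"
      using that D by (intro sum.cong) auto
    also have "\<dots> = (\<Sum>e\<in>E. \<Sum>k\<in>{1..n} - {i}. w e * of_bool (side e i \<noteq> side e k))"
      by (rule sum.swap)
    also have "\<dots> = (\<Sum>e\<in>E. w e * real (opp e i))"
      by (simp only: sum_distrib_left[symmetric] sum_opp)
    finally show ?thesis .
  qed
  have factor: "(real n - 2) * of_bool (side e i \<noteq> side e j) - real (opp e i) - real (opp e j) =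
      - 2 * weight_factor e i j" for e
  proof (cases "side e i = side e j")
    case True
    then have "opp e i = opp e j" by (simp add: opp_def)
    then show ?thesis using True by (simp add: weight_factor_def)
  next
    case False
    then have "real (opp e i) + real (opp e j) = real n" using opp_add by (metis of_nat_add)
    then show ?thesis using False by (simp add: weight_factor_def)
  qed
  have "S n D i j = (\<Sum>e\<in>E. w e *
      ((real n - 2) * of_bool (side e i \<noteq> side e j) - real (opp e i) - real (opp e j)))"
    unfolding S_def row[OF ij(1)] row[OF ij(2)] D[OF ij]
    by (simp only: sum_distrib_left sum_subtractf right_diff_distrib mult.left_commute)
  also have "\<dots> = - 2 * (\<Sum>e\<in>E. w e * weight_factor e i j)"
    unfolding factor sum_distrib_left by (intro sum.cong) auto
  finally show ?thesis .
qed

text \<open>Two distinct leaves on the same side both differ from the single leaf cut off, so the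
  side opposite to them has one element.\<close>

lemma weight_factor_pendant:
  assumes "e \<in> E - I" "i \<in> {1..n}" "j \<in> {1..n}" "i \<noteq> j"
  shows "weight_factor e i j = 1"
proof (cases "side e i = side e j")
  case True
  obtain l where l: "l \<in> {1..n}" "\<forall>k\<in>{1..n} - {l}. side e k \<noteq> side e l" using pendant assms(1) by blast
  have "j \<noteq> l" using True l(2) assms(2,4) by auto
  with l assms(3) have "{k \<in> {1..n}. side e k \<noteq> side e j} = {l}" by auto
  then show ?thesis using True by (simp add: weight_factor_def opp_def)
qed (simp add: weight_factor_def)

lemma opp_ge2:
  assumes "e \<in> I"
  shows "2 \<le> opp e j"
proof -
  have "{k \<in> {1..n}. side e k \<noteq> side e j} = {k \<in> {1..n}. side e k = (\<not> side e j)}" by auto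
  then show ?thesis using big[OF assms] by (simp add: opp_def)
qed

text \<open>The other edges have factor 1 for both pairs and cancel; only weights known to be
  positive remain.\<close>

lemma S_diff:
  assumes "i \<in> {1..n} - {j}" "i' \<in> {1..n} - {j}" "j \<in> {1..n}"
  shows "S n D i' j - S n D i j = 2 * (\<Sum>e\<in>I. w e * (weight_factor e i j - weight_factor e i' j))"
proof -
  have "S n D i' j - S n D i j = 2 * (\<Sum>e\<in>E. w e * (weight_factor e i j - weight_factor e i' j))"
    using assms by (simp add: S_eq sum_subtractf right_diff_distrib)
  also have "(\<Sum>e\<in>E. w e * (weight_factor e i j - weight_factor e i' j)) =
      (\<Sum>e\<in>I. w e * (weight_factor e i j - weight_factor e i' j))"
    using assms weight_factor_pendant by (intro sum.mono_neutral_right) (auto simp: finE IE)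
  finally show ?thesis .
qed

text \<open>An internal edge contributes to column \<open>j\<close> the least when it does not separate \<open>i\<close> from
  \<open>j\<close>, so the leaves related to \<open>j\<close>, if any, are exactly those attaining the minimum.\<close>

lemma S_minimal:
  assumes ij: "i \<in> {1..n} - {j}" "j \<in> {1..n}" "rel i j" and i': "i' \<in> {1..n} - {j}"
  shows "S n D i j \<le> S n D i' j" "S n D i' j = S n D i j \<longleftrightarrow> rel i' j"
proof -
  have fin: "finite I" using finE IE finite_subset by blast
  \<comment> \<open>The value \<open>opp e j - 1\<close> is strictly positive by
    \<open>opp_ge2\<close>, which decides the case of equality.\<close>
  have gap: "weight_factor e i j - weight_factor e i' j =
      (if side e i' = side e j then 0 else real (opp e j) - 1)" if "e \<in> I" for e
    using ij(3) that by (auto simp: weight_factor_def rel_def)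
  have nonneg: "0 \<le> w e * (weight_factor e i j - weight_factor e i' j)" if "e \<in> I" for e
    using gap[OF that] opp_ge2[OF that, of j] pos[OF that] by auto
  note diff = S_diff[OF ij(1) i' ij(2)]
  show "S n D i j \<le> S n D i' j"
    using diff sum_nonneg[of I "\<lambda>e. w e * (weight_factor e i j - weight_factor e i' j)"] nonneg
    by simp
  have "S n D i' j = S n D i j \<longleftrightarrow> (\<Sum>e\<in>I. w e * (weight_factor e i j - weight_factor e i' j)) = 0"
    using diff by linarith
  also have "\<dots> \<longleftrightarrow> (\<forall>e\<in>I. w e * (weight_factor e i j - weight_factor e i' j) = 0)"
    using nonneg by (intro sum_nonneg_eq_0_iff fin) auto
  also have "\<dots> \<longleftrightarrow> rel i' j"
    unfolding rel_def
  proof (intro ball_cong refl)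
    fix e assume e: "e \<in> I"
    show "w e * (weight_factor e i j - weight_factor e i' j) = 0 \<longleftrightarrow> side e i' = side e j"
      using gap[OF e] opp_ge2[OF e, of j] pos[OF e] by auto
  qed
  finally show "S n D i' j = S n D i j \<longleftrightarrow> rel i' j" .
qed

lemma partner_mem:
  assumes "j \<in> {1..n}"
  shows "partner n D j \<in> {1..n} - {j}"
proof -
  have "(if j = 1 then 2 else 1) \<in> {1..n} - {j}" using n by auto
  then have "(\<lambda>i. S n D i j) ` ({1..n} - {j}) \<noteq> {}" by blast
  then have "column_min n D j \<in> (\<lambda>i. S n D i j) ` ({1..n} - {j})"
    unfolding column_min_def by (intro Min_in) auto
  then have "{i \<in> {1..n} - {j}. S n D i j = column_min n D j} \<noteq> {}" by auto
  then have "partner n D j \<in> {i \<in> {1..n} - {j}. S n D i j = column_min n D j}"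
    unfolding partner_def by (intro Min_in) auto
  then show ?thesis by blast
qed

lemma partner_eq:
  assumes "i \<in> {1..n} - {j}" "j \<in> {1..n}" "rel i j"
  shows "partner n D j = Min {k \<in> {1..n} - {j}. rel k j}"
proof -
  have "column_min n D j = S n D i j"
    unfolding column_min_def
  proof (rule Min_eqI)
    show "S n D i j \<le> y" if "y \<in> (\<lambda>k. S n D k j) ` ({1..n} - {j})" for y
      using that S_minimal(1)[OF assms] by blast
  qed (use assms(1) in auto)
  then have "{k \<in> {1..n} - {j}. S n D k j = column_min n D j} = {k \<in> {1..n} - {j}. rel k j}"
    using S_minimal(2)[OF assms] by auto
  then show ?thesis by (simp add: partner_def)
qed

section \<open>Differences of two columns of \<open>D\<close>\<close>

abbreviation cut :: "'e \<Rightarrow> nat \<Rightarrow> nat \<Rightarrow> real" where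
  "cut e i j \<equiv> of_bool (side e i \<noteq> side e j)"

text \<open>If the leaf \<open>x\<close> cut off by \<open>e\<close> is \<open>i\<close> or
  \<open>j\<close>, then \<open>k\<close> and \<open>l\<close> lie on the same side; otherwise
  \<open>i\<close> and \<open>j\<close> do. Either way \<open>e\<close> cancels when rows
  \<open>k\<close> and \<open>l\<close> are compared.\<close>

lemma cut_diff_pendant:
  assumes e: "e \<in> E - I" and "i \<in> {1..n}" "j \<in> {1..n}" "k \<in> {1..n} - {i, j}" "l \<in> {1..n} - {i, j}"
  shows "cut e k i - cut e k j = cut e l i - cut e l j"
proof -
  obtain x where x: "x \<in> {1..n}" "\<forall>k\<in>{1..n} - {x}. side e k \<noteq> side e x" using pendant e by blast
  have s: "side e y = (side e x = (y = x))" if "y \<in> {1..n}" for y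
    using x that by (cases "y = x") auto
  have "side e i = side e j \<or> side e k = side e l"
  proof (cases "x = i \<or> x = j")
    case True then show ?thesis using s[of k] s[of l] assms(4,5) by auto
  next
    case False then show ?thesis using s[of i] s[of j] assms(2,3) by auto
  qed
  then show ?thesis by auto
qed

lemma D_diff:
  assumes "i \<in> {1..n}" "j \<in> {1..n}" "k \<in> {1..n}" "l \<in> {1..n}"
  shows "(D k i - D k j) - (D l i - D l j) =
    (\<Sum>e\<in>E. w e * ((cut e k i - cut e k j) - (cut e l i - cut e l j)))"
  using assms by (simp add: D sum_subtractf right_diff_distrib)

lemma rel_const:
  assumes ij: "i \<in> {1..n}" "j \<in> {1..n}" "rel i j"
    and kl: "k \<in> {1..n} - {i, j}" "l \<in> {1..n} - {i, j}"
  shows "D k i - D k j = D l i - D l j"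
proof -
  have "(cut e k i - cut e k j) - (cut e l i - cut e l j) = 0" if "e \<in> E" for e
  proof (cases "e \<in> I")
    case True then show ?thesis using ij(3) by (simp add: rel_def)
  next
    case False then show ?thesis using cut_diff_pendant[of e i j k l] that ij kl by simp
  qed
  then have "(D k i - D k j) - (D l i - D l j) = 0"
    using D_diff[of i j k l] ij kl by simp
  then show ?thesis by simp
qed

lemma same_side_other:
  assumes "e \<in> I"
  obtains k where "k \<in> {1..n}" "k \<noteq> i" "side e k = side e i"
proof -
  have "\<not> {k \<in> {1..n}. side e k = side e i} \<subseteq> {i}"
    using big[OF assms, of "side e i"] card_mono[of "{i}" "{k \<in> {1..n}. side e k = side e i}"] by auto
  then show thesis using that by blast
qed

text \<open>If an internal edge \<open>e\<close> separates \<open>i\<close> from \<open>j\<close>, then a leaf \<open>k\<close> on the side of \<open>j\<close> and a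
  leaf \<open>l\<close> on the side of \<open>i\<close> witness that the columns do not differ by a constant: by compatibility
  no other edge can compensate the contribution of \<open>e\<close>.\<close>

lemma const_rel:
  assumes ij: "i \<in> {1..n}" "j \<in> {1..n}" and const: "\<forall>k\<in>{1..n} - {i, j}. D k i - D k j = c"
  shows "rel i j"
proof (rule ccontr)
  assume "\<not> rel i j"
  then obtain e where e: "e \<in> I" "side e i \<noteq> side e j" by (auto simp: rel_def)
  obtain k where k: "k \<in> {1..n}" "k \<noteq> j" "side e k = side e j" using same_side_other[OF e(1)] .
  obtain l where l: "l \<in> {1..n}" "l \<noteq> i" "side e l = side e i" using same_side_other[OF e(1)] .
  have kl: "k \<noteq> i" "l \<noteq> j" using k l e by auto
  \<comment> \<open>The coefficient of \<open>w f\<close> in the difference between rows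
    \<open>k\<close> and \<open>l\<close>; at \<open>f = e\<close> it is 2.\<close>
  define t where "t f = (cut f k i - cut f k j) - (cut f l i - cut f l j)" for f
  have "0 \<le> w f * t f" if f: "f \<in> E" for f
  proof (cases "f \<in> I")
    case False
    then show ?thesis using cut_diff_pendant[of f i j k l] f ij k l kl by (simp add: t_def)
  next
    case True
    have "0 \<le> t f"
    proof (cases "f = e")
      case True then show ?thesis using e k l by (simp add: t_def)
    next
      case False
      \<comment> \<open>The only constellation with negative \<open>t f\<close>. Together with the
        sides of \<open>e\<close>, the leaves \<open>i\<close>, \<open>j\<close>, \<open>k\<close>,
        \<open>l\<close> would meet all four intersections of sides.\<close>
      have "\<not> (side f i \<noteq> side f j \<and> side f k = side f i \<and> side f l = side f j)"
      proof
        assume h: "side f i \<noteq> side f j \<and> side f k = side f i \<and> side f l = side f j"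
        obtain b c where bc: "\<forall>k\<in>{1..n}. \<not> (side f k = b \<and> side e k = c)"
          using compat[OF \<open>f \<in> I\<close> e(1) False] by blast
        show False using bc[rule_format, of i] bc[rule_format, of j] bc[rule_format, of k]
            bc[rule_format, of l] h ij k l e(2) by blast
      qed
      then show ?thesis by (auto simp: t_def)
    qed
    then show ?thesis using pos[OF True] by simp
  qed
  moreover have "0 < w e * t e" using pos[OF e(1)] e(2) k(3) l(3) by (auto simp: t_def)
  ultimately have "0 < (\<Sum>f\<in>E. w f * t f)"
    using e(1) IE finE by (intro sum_pos2[of E e]) auto
  then have "(D k i - D k j) - (D l i - D l j) > 0"
    using D_diff[of i j k l] ij k l by (simp add: t_def)
  moreover have "D k i - D k j = c" "D l i - D l j = c" using const k l kl by auto
  ultimately show False by simp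
qed

lemma kept_imp_rel:
  assumes "j \<in> {1..n}" "kept n D j"
  shows "rel (partner n D j) j"
proof -
  obtain c where "\<forall>k\<in>{1..n} - {j, partner n D j}. D k (partner n D j) - D k j = c"
    using assms(2) by (auto simp: kept_def)
  then show ?thesis
    using const_rel[of "partner n D j" j c] partner_mem[OF assms(1)] assms(1)
    by (simp add: insert_commute)
qed

lemma rel_imp_kept:
  assumes ij: "i \<in> {1..n} - {j}" "j \<in> {1..n}" "rel i j"
  shows "kept n D j"
proof -
  let ?p = "partner n D j"
  have "?p = Min {k \<in> {1..n} - {j}. rel k j}" by (rule partner_eq[OF assms])
  moreover have "Min {k \<in> {1..n} - {j}. rel k j} \<in> {k \<in> {1..n} - {j}. rel k j}"
    using ij by (intro Min_in) auto
  ultimately have p: "?p \<in> {1..n}" "rel ?p j" by auto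
  show ?thesis
  proof (cases "{1..n} - {j, ?p} = {}")
    case True then show ?thesis unfolding kept_def by blast
  next
    case False
    then obtain l where "l \<in> {1..n} - {j, ?p}" by blast
    then have "D k ?p - D k j = D l ?p - D l j" if "k \<in> {1..n} - {j, ?p}" for k
      using rel_const[OF p(1) ij(2) p(2), of k l] that by blast
    then show ?thesis unfolding kept_def by blast
  qed
qed

lemma kept_iff:
  assumes "j \<in> {1..n}"
  shows "kept n D j \<longleftrightarrow> (\<exists>i\<in>{1..n} - {j}. rel i j)"
  using kept_imp_rel[OF assms] partner_mem[OF assms] rel_imp_kept[OF _ assms] by blast

text \<open>Leaf indices start at 1, so 0 is free to mark rejected indices. This is the value that
  the program leaves in the array \<open>cherry\<close>.\<close>

definition label :: "nat \<Rightarrow> nat" where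
  "label j = (if kept n D j then min j (partner n D j) else 0)"

lemma label_eq_Min:
  assumes j: "j \<in> {1..n}" "kept n D j"
  shows "label j = Min {i \<in> {1..n}. rel i j}"
proof -
  obtain i where i: "i \<in> {1..n} - {j}" "rel i j" using j kept_iff by blast
  have "{i \<in> {1..n}. rel i j} = insert j {k \<in> {1..n} - {j}. rel k j}" using j by auto
  moreover have "Min (insert j {k \<in> {1..n} - {j}. rel k j}) = min j (Min {k \<in> {1..n} - {j}. rel k j})"
    using i by (intro Min_insert) auto
  ultimately show ?thesis using partner_eq[OF i(1) j(1) i(2)] j(2) by (simp add: label_def)
qed

text \<open>A nonzero label of \<open>j\<close> is \<open>j\<close> or its partner, hence related to
  \<open>j\<close>; a common label thus relates all of \<open>A\<close>. Conversely, as
  \<open>A\<close> has two members, each has a related companion and is kept.\<close>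

lemma label_iff:
  assumes A: "A \<subseteq> {1..n}" "2 \<le> card A"
  shows "(\<exists>c. c \<noteq> 0 \<and> (\<forall>j\<in>A. label j = c)) \<longleftrightarrow> (\<forall>a\<in>A. \<forall>b\<in>A. rel a b)"
proof
  assume "\<exists>c. c \<noteq> 0 \<and> (\<forall>j\<in>A. label j = c)"
  then obtain c where c: "c \<noteq> 0" "\<forall>j\<in>A. label j = c" by blast
  have "rel c j" if "j \<in> A" for j
  proof -
    have "kept n D j" using c that by (auto simp: label_def split: if_splits)
    moreover from this have "c = j \<or> c = partner n D j"
      using c that by (auto simp: label_def min_def split: if_splits)
    ultimately show ?thesis using kept_imp_rel[of j] that A by auto
  qed
  then show "\<forall>a\<in>A. \<forall>b\<in>A. rel a b" using rel_sym rel_trans by blast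
next
  assume r: "\<forall>a\<in>A. \<forall>b\<in>A. rel a b"
  have kept: "kept n D j" if "j \<in> A" for j
  proof -
    have "\<not> A \<subseteq> {j}" using A(2) card_mono[of "{j}" A] by auto
    then show ?thesis using r that A(1) kept_iff[of j] by blast
  qed
  obtain a where a: "a \<in> A" using A(2) by (metis card.empty ex_in_conv not_numeral_le_zero)
  have "label j = label a" if "j \<in> A" for j
  proof -
    have "{i \<in> {1..n}. rel i j} = {i \<in> {1..n}. rel i a}"
      using r that a rel_trans by blast
    then show ?thesis using label_eq_Min kept that a A(1) by (metis subsetD)
  qed
  moreover have "label a \<noteq> 0"
    using kept[OF a] a A(1) partner_mem[of a] by (auto simp: label_def min_def)
  ultimately show "\<exists>c. c \<noteq> 0 \<and> (\<forall>j\<in>A. label j = c)" by blast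
qed

text \<open>At most one reversed couple leads from a kept index to its label, and related indices
  share their label. The closure is taken because two larger members of a class are joined only
  through its least one.\<close>

lemma rtrancl_kept_couples_iff:
  assumes ab: "a \<in> {1..n}" "b \<in> {1..n}"
  shows "(a, b) \<in> (kept_couples n D \<union> (kept_couples n D)\<inverse>)\<^sup>* \<longleftrightarrow> rel a b"
proof
  assume "(a, b) \<in> (kept_couples n D \<union> (kept_couples n D)\<inverse>)\<^sup>*"
  then show "rel a b"
  proof (induction rule: rtrancl_induct)
    case (step y z)
    then have "rel y z" using kept_imp_rel rel_sym by (auto simp: kept_couples_def)
    then show ?case using step rel_trans by blast
  qed simp
next
  let ?R = "kept_couples n D \<union> (kept_couples n D)\<inverse>"
  assume r: "rel a b"
  have to_min: "(x, label x) \<in> ?R\<^sup>*" if "x \<in> {1..n}" "kept n D x" for x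
    using that by (auto simp: label_def min_def kept_couples_def)
  show "(a, b) \<in> ?R\<^sup>*"
  proof (cases "a = b")
    case False
    then have k: "kept n D a" "kept n D b" using kept_iff ab r rel_sym by blast+
    have "{i \<in> {1..n}. rel i a} = {i \<in> {1..n}. rel i b}" using r rel_sym rel_trans by blast
    then have "label a = label b" using label_eq_Min ab k by simp
    moreover have "sym (?R\<^sup>*)" by (intro sym_rtrancl) (auto simp: sym_def)
    ultimately show ?thesis using to_min[OF ab(1) k(1)] to_min[OF ab(2) k(2)]
      by (metis symD rtrancl_trans)
  qed simp
qed

end

section \<open>A quadratic program\<close>

abbreviation set_nvar :: "string \<Rightarrow> nat \<Rightarrow> store \<Rightarrow> store" where
  "set_nvar x i s \<equiv> s\<lparr>nvar := (nvar s)(x := i)\<rparr>"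

lemma final_simps [simp]:
  "final (Seq c d) s = final d (final c s)"
  "final (Cond b c d) s = (if bval b s then final c s else final d s)"
  by (simp_all add: Let_def split: prod.split)

lemma operations_simps [simp]:
  "operations (Seq c d) s = operations c s + operations d (final c s)"
  "operations (Cond b c d) s =
     1 + bcost b + (if bval b s then operations c s else operations d s)"
  by (simp_all add: Let_def split: prod.split)

declare run.simps(4-6) [simp del]

lemma final_For:
  "final (For x e c) s = fold (\<lambda>i t. final c (set_nvar x i t)) [1..<Suc (nval e s)] s"
proof -
  have "fst (fold (\<lambda>i (s, t). let (s', t') = run c (set_nvar x i s) in (s', t + 1 + t')) xs (s, k)) =
      fold (\<lambda>i t. final c (set_nvar x i t)) xs s" for xs s k
    by (induction xs arbitrary: s k) (auto simp: Let_def split: prod.split)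
  then show ?thesis by (simp only: run.simps)
qed

text \<open>The invariant is indexed by the number of completed iterations; the next one runs with
  \<open>Suc i\<close>, since loops start at 1.\<close>

lemma For_invariant:
  assumes init: "Inv 0 s"
    and step: "\<And>i t. i < nval e s \<Longrightarrow> Inv i t \<Longrightarrow> Inv (Suc i) (final c (set_nvar x (Suc i) t))"
  shows "Inv (nval e s) (final (For x e c) s)"
proof -
  have "m \<le> nval e s \<Longrightarrow> Inv m (fold (\<lambda>i t. final c (set_nvar x i t)) [1..<Suc m] s)" for m
  proof (induction m)
    case (Suc m)
    moreover have "[1..<Suc (Suc m)] = [1..<Suc m] @ [Suc m]" by simp
    ultimately show ?case using step[of m] by (simp only: fold_append fold_simps o_apply Suc_le_lessD
        less_imp_le)
  qed (simp add: init)
  then show ?thesis by (simp only: final_For)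
qed

text \<open>\<open>Q\<close> carries along whatever the bound \<open>K\<close> on the body depends
  on; the 1 in \<open>1 + K\<close> is the charge for the iteration itself.\<close>

lemma operations_For_le:
  assumes Q: "Q s" and step: "\<And>i t. Q t \<Longrightarrow> Q (final c (set_nvar x i t)) \<and> operations c (set_nvar x i t) \<le> K"
  shows "operations (For x e c) s \<le> 1 + ncost e + nval e s * (1 + K)"
proof -
  define F where "F = (\<lambda>i (s, t). let (s', t') = run c (set_nvar x i s) in (s', t + 1 + t'))"
  have "Q s \<Longrightarrow> snd (fold F xs (s, k)) \<le> k + length xs * (1 + K)" for xs s k
  proof (induction xs arbitrary: s k)
    case (Cons i xs)
    obtain s' t' where r: "run c (set_nvar x i s) = (s', t')" by fastforce
    have "Q s'" "t' \<le> K" using step[OF Cons.prems, of i] unfolding r by auto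
    moreover have "F i (s, k) = (s', k + 1 + t')" unfolding F_def prod.case r Let_def ..
    ultimately show ?case using Cons.IH[of s' "k + 1 + t'"] by simp
  qed simp
  from this[OF Q, of "[1..<Suc (nval e s)]" "1 + ncost e"]
  have "snd (fold F [1..<Suc (nval e s)] (s, 1 + ncost e)) \<le> 1 + ncost e + nval e s * (1 + K)"
    by (simp del: upt_Suc)
  then show ?thesis by (simp only: run.simps F_def)
qed

section \<open>Static frame conditions and cost bounds\<close>

primrec loop_vars :: "cmd \<Rightarrow> string set" where
  "loop_vars Skip = {}"
| "loop_vars (NSet a i e) = {}"
| "loop_vars (RSet a i j p) = {}"
| "loop_vars (Seq c d) = loop_vars c \<union> loop_vars d"
| "loop_vars (Cond b c d) = loop_vars c \<union> loop_vars d"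
| "loop_vars (For x e c) = insert x (loop_vars c)"

primrec narr_writes :: "cmd \<Rightarrow> (string \<times> nexp) set" where
  "narr_writes Skip = {}"
| "narr_writes (NSet a i e) = {(a, i)}"
| "narr_writes (RSet a i j p) = {}"
| "narr_writes (Seq c d) = narr_writes c \<union> narr_writes d"
| "narr_writes (Cond b c d) = narr_writes c \<union> narr_writes d"
| "narr_writes (For x e c) = narr_writes c"

primrec rarr_writes :: "cmd \<Rightarrow> string set" where
  "rarr_writes Skip = {}"
| "rarr_writes (NSet a i e) = {}"
| "rarr_writes (RSet a i j p) = {a}"
| "rarr_writes (Seq c d) = rarr_writes c \<union> rarr_writes d"
| "rarr_writes (Cond b c d) = rarr_writes c \<union> rarr_writes d"
| "rarr_writes (For x e c) = rarr_writes c"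

lemma nvar_final [simp]: "y \<notin> loop_vars c \<Longrightarrow> nvar (final c s) y = nvar s y"
proof (induction c arbitrary: s)
  case (For x e c)
  show ?case
    by (rule For_invariant[where Inv = "\<lambda>_ (t :: store). nvar t y = nvar s y"]) (use For in auto)
qed auto

lemma rarr_final [simp]: "a \<notin> rarr_writes c \<Longrightarrow> rarr (final c s) a = rarr s a"
proof (induction c arbitrary: s)
  case (For x e c)
  show ?case
    by (rule For_invariant[where Inv = "\<lambda>_ (t :: store). rarr t a = rarr s a"]) (use For in auto)
qed auto

lemma narr_final [simp]:
  "a \<notin> fst ` narr_writes c \<Longrightarrow> narr (final c s) a = narr s a"
proof (induction c arbitrary: s)
  case (For x e c)
  show ?case
    by (rule For_invariant[where Inv = "\<lambda>_ (t :: store). narr t a = narr s a"]) (use For in auto)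
qed (auto simp: image_Un)

text \<open>All writes to \<open>a\<close> hit the cell addressed by \<open>x\<close>, which no loop
  reassigns. With \<open>x\<close> the column variable, this preserves the results of earlier
  columns.\<close>

lemma narr_final_other:
  "\<lbrakk>\<And>i. (a, i) \<in> narr_writes c \<Longrightarrow> i = NVar x; x \<notin> loop_vars c; y \<noteq> nvar s x\<rbrakk>
   \<Longrightarrow> narr (final c s) a y = narr s a y"
proof (induction c arbitrary: s)
  case (For z e c)
  have "nvar (final (For z e c) s) x = nvar s x \<and> narr (final (For z e c) s) a y = narr s a y"
    by (rule For_invariant[where Inv = "\<lambda>_ (t :: store). nvar t x = nvar s x \<and> narr t a y = narr s a y"])
      (use For in auto)
  then show ?case ..
qed auto

text \<open>A worst case read off the program text: a conditional is charged for both branches, and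
  every loop is taken to run \<open>N\<close> times.\<close>

primrec cost_bound :: "cmd \<Rightarrow> nat \<Rightarrow> nat" where
  "cost_bound Skip N = 1"
| "cost_bound (NSet a i e) N = 1 + ncost i + ncost e"
| "cost_bound (RSet a i j p) N = 1 + ncost i + ncost j + rcost p"
| "cost_bound (Seq c d) N = cost_bound c N + cost_bound d N"
| "cost_bound (Cond b c d) N = 1 + bcost b + (cost_bound c N + cost_bound d N)"
| "cost_bound (For x e c) N = 1 + ncost e + N * (1 + cost_bound c N)"

primrec loops_to :: "string \<Rightarrow> cmd \<Rightarrow> bool" where
  "loops_to y Skip \<longleftrightarrow> True"
| "loops_to y (NSet a i e) \<longleftrightarrow> True"
| "loops_to y (RSet a i j p) \<longleftrightarrow> True"
| "loops_to y (Seq c d) \<longleftrightarrow> loops_to y c \<and> loops_to y d"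
| "loops_to y (Cond b c d) \<longleftrightarrow> loops_to y c \<and> loops_to y d"
| "loops_to y (For x e c) \<longleftrightarrow> e = NVar y \<and> x \<noteq> y \<and> loops_to y c"

lemma loops_to_loop_vars: "loops_to y c \<Longrightarrow> y \<notin> loop_vars c"
  by (induction c) auto

lemma operations_le_cost_bound:
  "loops_to y c \<Longrightarrow> operations c s \<le> cost_bound c (nvar s y)"
proof (induction c arbitrary: s)
  case (Seq c d)
  then have "operations d (final c s) \<le> cost_bound d (nvar (final c s) y)" by auto
  then show ?case using Seq loops_to_loop_vars by (simp add: add_mono)
next
  case (For x e c)
  then have c: "loops_to y c" "x \<noteq> y" "e = NVar y" by auto
  have "operations (For x e c) s \<le> 1 + ncost e + nval e s * (1 + cost_bound c (nvar s y))"
  proof (rule operations_For_le[where Q = "\<lambda>(t :: store). nvar t y = nvar s y"])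
    fix i and t :: store assume "nvar t y = nvar s y"
    then show "nvar (final c (set_nvar x i t)) y = nvar s y \<and>
        operations c (set_nvar x i t) \<le> cost_bound c (nvar s y)"
      using For.IH[OF c(1), of "set_nvar x i t"] c loops_to_loop_vars by simp
  qed simp
  then show ?case using c by simp
qed (auto simp: trans_le_add1 trans_le_add2)

section \<open>The program: row sums, scan of a column, difference test, labels\<close>

definition row_sum_body :: cmd where
  "row_sum_body = Cond (NEq (NVar ''i'') (NVar ''k'')) Skip
     (RSet ''R'' (NVar ''i'') (NConst 0)
       (RAdd (RArr ''R'' (NVar ''i'') (NConst 0)) (RArr ''D'' (NVar ''i'') (NVar ''k''))))"

text \<open>Row sums computed beforehand make every entry of \<open>S\<close> available at constant
  cost, which keeps the scan of all columns quadratic. Real arrays have two indices; the sums sit at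
  second index 0.\<close>

definition row_sums :: cmd where
  "row_sums = For ''i'' (NVar ''n'')
     (Seq (RSet ''R'' (NVar ''i'') (NConst 0) (RNat (NConst 0)))
       (For ''k'' (NVar ''n'') row_sum_body))"

definition S_exp :: "nexp \<Rightarrow> rexp" where
  "S_exp a = RSub (RSub
     (RMul (RSub (RNat (NVar ''n'')) (RNat (NConst 2))) (RArr ''D'' a (NVar ''j'')))
     (RArr ''R'' a (NConst 0))) (RArr ''R'' (NVar ''j'') (NConst 0))"

abbreviation at_j :: "string \<Rightarrow> nexp" where "at_j a \<equiv> NArr a (NVar ''j'')"

text \<open>The negated conjunction is a disjunction: the candidate is replaced if there is none
  yet, marked by 0, or if row \<open>i\<close> is strictly smaller. Strictness keeps the least index
  among ties. With candidate 0 the comparison reads arbitrary cells, but its outcome does not affect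
  the condition.\<close>

definition scan_body :: cmd where
  "scan_body = Cond (BAnd (BNot (NEq (NVar ''i'') (NVar ''j'')))
       (BNot (BAnd (BNot (NEq (at_j ''partner'') (NConst 0)))
         (BNot (RLess (S_exp (NVar ''i'')) (S_exp (at_j ''partner'')))))))
     (NSet ''partner'' (NVar ''j'') (NVar ''i'')) Skip"

definition diff_exp :: "nexp \<Rightarrow> rexp" where
  "diff_exp k = RSub (RArr ''D'' k (at_j ''partner'')) (RArr ''D'' k (NVar ''j''))"

text \<open>All differences are compared with that of one reference row, the first one other than
  \<open>j\<close> and its partner; its index is stored in \<open>ref\<close>, where 0 means none so
  far. One pass per column is then enough.\<close>

definition check_body :: cmd where
  "check_body = Cond (BAnd (BNot (NEq (NVar ''k'') (NVar ''j''))) (BNot (NEq (NVar ''k'') (at_j ''partner''))))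
     (Cond (NEq (NArr ''ref'' (NConst 0)) (NConst 0))
       (NSet ''ref'' (NConst 0) (NVar ''k''))
       (Cond (REq (diff_exp (NVar ''k'')) (diff_exp (NArr ''ref'' (NConst 0)))) Skip
         (NSet ''kept'' (NVar ''j'') (NConst 0))))
     Skip"

definition label_cmd :: cmd where
  "label_cmd = Cond (NEq (at_j ''kept'') (NConst 0))
     (NSet ''cherry'' (NVar ''j'') (NConst 0))
     (Cond (NLess (at_j ''partner'') (NVar ''j''))
       (NSet ''cherry'' (NVar ''j'') (at_j ''partner''))
       (NSet ''cherry'' (NVar ''j'') (NVar ''j'')))"

definition scan :: cmd where
  "scan = Seq (NSet ''partner'' (NVar ''j'') (NConst 0)) (For ''i'' (NVar ''n'') scan_body)"

definition check :: cmd where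
  "check = Seq (Seq (NSet ''kept'' (NVar ''j'') (NConst 1)) (NSet ''ref'' (NConst 0) (NConst 0)))
     (For ''k'' (NVar ''n'') check_body)"

definition columns :: cmd where
  "columns = For ''j'' (NVar ''n'') (Seq scan (Seq check label_cmd))"

definition program :: cmd where "program = Seq row_sums columns"

lemmas program_defs = row_sum_body_def row_sums_def S_exp_def scan_body_def diff_exp_def
  check_body_def label_cmd_def scan_def check_def columns_def program_def

lemma program_quadratic:
  assumes "1 \<le> nvar s ''n''"
  shows "operations program s \<le> 163 * (nvar s ''n'')\<^sup>2"
proof -
  define N where "N = nvar s ''n''"
  have N: "1 \<le> N" "N \<le> N * N" using assms by (auto simp: N_def)
  have "loops_to ''n'' program" by (simp add: program_defs)
  then have "operations program s \<le> cost_bound program N" unfolding N_def by (rule operations_le_cost_bound)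
  also have "cost_bound program N = 4 + 42 * N + 117 * (N * N)"
    by (simp add: program_defs algebra_simps)
  \<comment> \<open>\<open>163 = 4 + 42 + 117\<close>; the lower terms are absorbed by
    \<open>N * N\<close>.\<close>
  also have "\<dots> \<le> 163 * (N * N)" using N by linarith
  finally show ?thesis by (simp add: N_def power2_eq_square)
qed

section \<open>Correctness of the program\<close>

definition ready :: "nat \<Rightarrow> (nat \<Rightarrow> nat \<Rightarrow> real) \<Rightarrow> store \<Rightarrow> bool" where
  "ready n D s \<longleftrightarrow> input n D s \<and> (\<forall>i\<in>{1..n}. rarr s ''R'' i 0 = (\<Sum>k\<in>{1..n} - {i}. D i k))"

lemma atLeastAtMost_Suc_Diff:
  "{1..Suc m} - A = (if Suc m \<in> A then {1..m} - A else insert (Suc m) ({1..m} - A))"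
  by (auto simp: le_Suc_eq)

lemma row_sums_ready:
  assumes "input n D s"
  shows "ready n D (final row_sums s)"
proof -
  define Inv where "Inv m t \<longleftrightarrow> input n D t \<and>
    (\<forall>i\<in>{1..m}. rarr t ''R'' i 0 = (\<Sum>k\<in>{1..n} - {i}. D i k))" for m t
  have "Inv (nval (NVar ''n'') s) (final row_sums s)"
    unfolding row_sums_def
  proof (rule For_invariant)
    show "Inv 0 s" using assms by (simp add: Inv_def)
  next
    fix i t assume i: "i < nval (NVar ''n'') s" and t: "Inv i t"
    define a where "a = Suc i"
    define t0 where "t0 = final (RSet ''R'' (NVar ''i'') (NConst 0) (RNat (NConst 0))) (set_nvar ''i'' a t)"
    have n: "nvar s ''n'' = n" "nvar t0 ''n'' = n" "nvar t0 ''i'' = a"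
      using assms t by (auto simp: input_def Inv_def t0_def)
    have a: "a \<in> {1..n}" using i n by (simp add: a_def)
    have D: "rarr t0 ''D'' a k = D a k" if "k \<in> {1..n}" for k
      using t a that by (auto simp: input_def Inv_def t0_def)
    \<comment> \<open>The inner loop builds the partial sum of row \<open>a\<close> and leaves the
      sums of the other rows alone.\<close>
    define J where "J k u \<longleftrightarrow> nvar u ''i'' = a \<and> rarr u ''D'' = rarr t0 ''D'' \<and>
      (\<forall>b. b \<noteq> a \<longrightarrow> rarr u ''R'' b 0 = rarr t ''R'' b 0) \<and>
      rarr u ''R'' a 0 = (\<Sum>k\<in>{1..k} - {a}. D a k)" for k and u :: store
    have "J (nval (NVar ''n'') t0) (final (For ''k'' (NVar ''n'') row_sum_body) t0)"
    proof (rule For_invariant)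
      show "J 0 t0" by (simp add: J_def t0_def)
    next
      fix k and u :: store assume k: "k < nval (NVar ''n'') t0" and u: "J k u"
      have "Suc k \<in> {1..n}" using k n by simp
      then have "rarr u ''D'' a (Suc k) = D a (Suc k)" using u D by (simp add: J_def)
      moreover have "(\<Sum>l\<in>{1..Suc k} - {a}. D a l) =
          (\<Sum>l\<in>{1..k} - {a}. D a l) + (if Suc k = a then 0 else D a (Suc k))"
        unfolding atLeastAtMost_Suc_Diff by auto
      ultimately show "J (Suc k) (final row_sum_body (set_nvar ''k'' (Suc k) u))"
        using u unfolding J_def by (auto simp: row_sum_body_def)
    qed
    then have J: "J n (final (For ''k'' (NVar ''n'') row_sum_body) t0)" using n by simp
    have "input n D (final (For ''k'' (NVar ''n'') row_sum_body) t0)"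
      using t by (auto simp: input_def Inv_def t0_def row_sum_body_def)
    then have "Inv a (final (For ''k'' (NVar ''n'') row_sum_body) t0)"
      using t J a unfolding Inv_def J_def by (auto simp: a_def le_Suc_eq)
    then show "Inv (Suc i) (final (Seq (RSet ''R'' (NVar ''i'') (NConst 0) (RNat (NConst 0)))
        (For ''k'' (NVar ''n'') row_sum_body)) (set_nvar ''i'' (Suc i) t))"
      by (simp add: a_def t0_def)
  qed
  then show ?thesis using assms by (simp add: Inv_def ready_def input_def)
qed

lemma ready_final:
  assumes "ready n D s" "''n'' \<notin> loop_vars c" "rarr_writes c = {}"
  shows "ready n D (final c s)"
  using assms by (auto simp: ready_def input_def)

lemma ready_set_nvar: "ready n D s \<Longrightarrow> x \<noteq> ''n'' \<Longrightarrow> ready n D (set_nvar x i s)"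
  by (simp add: ready_def input_def)

lemma rval_S_exp:
  assumes "ready n D s" "nvar s ''j'' \<in> {1..n}" "nval a s \<in> {1..n}"
  shows "rval (S_exp a) s = S n D (nval a s) (nvar s ''j'')"
  using assms by (auto simp: S_exp_def S_def ready_def input_def)

text \<open>Minimality and least index in one condition that a single pass can maintain, whereas
  \<open>partner\<close> refers to the finished minimum of the column.\<close>

definition first_min :: "(nat \<Rightarrow> real) \<Rightarrow> nat set \<Rightarrow> nat \<Rightarrow> bool" where
  "first_min f X p \<longleftrightarrow> p \<in> X \<and> (\<forall>i\<in>X. f p \<le> f i \<and> (i < p \<longrightarrow> f p < f i))"

text \<open>The new index exceeds all earlier ones, so a tie is resolved in favour of
  \<open>p\<close>.\<close>

lemma first_min_insert:
  assumes "first_min f X p" "\<And>i. i \<in> X \<Longrightarrow> i < q"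
  shows "first_min f (insert q X) (if f q < f p then q else p)"
proof (cases "f q < f p")
  case True
  then have "f q < f i" if "i \<in> X" for i
    using assms(1) that less_le_trans unfolding first_min_def by blast
  then show ?thesis using True by (auto simp: first_min_def less_imp_le)
next
  case False
  then show ?thesis using assms by (auto simp: first_min_def dest: less_asym)
qed

lemma first_min_partner:
  assumes "first_min (\<lambda>i. S n D i j) ({1..n} - {j}) p"
  shows "partner n D j = p"
proof -
  have p: "p \<in> {1..n} - {j}" "\<And>i. i \<in> {1..n} - {j} \<Longrightarrow> S n D p j \<le> S n D i j"
    "\<And>i. i \<in> {1..n} - {j} \<Longrightarrow> i < p \<Longrightarrow> S n D p j < S n D i j"
    using assms by (auto simp: first_min_def)
  have "column_min n D j = S n D p j"
    unfolding column_min_def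
  proof (rule Min_eqI)
    show "S n D p j \<le> y" if "y \<in> (\<lambda>i. S n D i j) ` ({1..n} - {j})" for y using that p(2) by blast
  qed (use p(1) in auto)
  then show ?thesis
    unfolding partner_def
  proof (intro Min_eqI)
    fix i assume i: "i \<in> {i \<in> {1..n} - {j}. S n D i j = column_min n D j}"
    show "p \<le> i"
    proof (rule ccontr)
      assume "\<not> p \<le> i"
      then have "S n D p j < S n D i j" using p(3)[of i] i by simp
      then show False using i \<open>column_min n D j = S n D p j\<close> by simp
    qed
  qed (use p(1) in auto)
qed

lemma scan_partner:
  assumes s: "ready n D s" and j: "nvar s ''j'' = j" "j \<in> {1..n}" and n: "2 \<le> n"
  shows "narr (final scan s) ''partner'' j = partner n D j"
proof -
  define s0 where "s0 = final (NSet ''partner'' (NVar ''j'') (NConst 0)) s"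
  have s0: "ready n D s0" unfolding s0_def by (rule ready_final[OF s]) auto
  define Inv where "Inv m t \<longleftrightarrow> ready n D t \<and> nvar t ''j'' = j \<and>
    (if {1..m} - {j} = {} then narr t ''partner'' j = 0
     else first_min (\<lambda>i. S n D i j) ({1..m} - {j}) (narr t ''partner'' j))" for m t
  have "Inv (nval (NVar ''n'') s0) (final (For ''i'' (NVar ''n'') scan_body) s0)"
  proof (rule For_invariant)
    show "Inv 0 s0" using s0 j by (simp add: Inv_def s0_def)
  next
    fix m t assume "m < nval (NVar ''n'') s0" and t: "Inv m t"
    then have m: "m < n" using s0 by (simp add: ready_def input_def)
    define u where "u = set_nvar ''i'' (Suc m) t"
    have u: "ready n D u" "nvar u ''j'' = j" "nvar u ''i'' = Suc m" "narr u = narr t"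
      using t ready_set_nvar[of n D t "''i''"] by (auto simp: Inv_def u_def)
    have ready': "ready n D (final scan_body u)"
      using u(1) by (rule ready_final) (auto simp: scan_body_def)
    have j': "nvar (final scan_body u) ''j'' = j" using u(2) by (simp add: scan_body_def)
    let ?p = "narr t ''partner'' j"
    have Si: "rval (S_exp (NVar ''i'')) u = S n D (Suc m) j"
      using rval_S_exp[OF u(1), of "NVar ''i''"] u j m by simp
    have Sp: "rval (S_exp (at_j ''partner'')) u = S n D ?p j" if "{1..m} - {j} \<noteq> {}"
    proof -
      have "?p \<in> {1..m} - {j}" using t that by (simp add: Inv_def first_min_def split: if_splits)
      then show ?thesis using rval_S_exp[OF u(1), of "at_j ''partner''"] u j m by simp
    qed
    have new: "narr (final scan_body u) ''partner'' j =
      (if Suc m \<noteq> j \<and> ({1..m} - {j} = {} \<or> S n D (Suc m) j < S n D ?p j) then Suc m else ?p)"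
    proof (cases "{1..m} - {j} = {}")
      case True
      then have "?p = 0" using t by (simp add: Inv_def)
      then show ?thesis using True u by (auto simp: scan_body_def)
    next
      case False
      then have "?p \<in> {1..m} - {j}" using t by (simp add: Inv_def first_min_def split: if_splits)
      then have "?p \<noteq> 0" by auto
      then show ?thesis unfolding scan_body_def final_simps bval.simps Si Sp[OF False] using False u by auto
    qed
    have "if {1..Suc m} - {j} = {} then narr (final scan_body u) ''partner'' j = 0
     else first_min (\<lambda>i. S n D i j) ({1..Suc m} - {j}) (narr (final scan_body u) ''partner'' j)"
    proof (cases "Suc m = j")
      case True
      then have X: "{1..Suc m} - {j} = {1..m} - {j}" by (auto simp: le_Suc_eq)
      have eq: "narr (final scan_body u) ''partner'' j = ?p" using new True by simp
      show ?thesis unfolding X eq using t unfolding Inv_def by blast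
    next
      case False
      then have X: "{1..Suc m} - {j} = insert (Suc m) ({1..m} - {j})" by (auto simp: le_Suc_eq)
      show ?thesis
      proof (cases "{1..m} - {j} = {}")
        case True
        then show ?thesis using new False unfolding X True by (simp add: first_min_def)
      next
        case ne: False
        then have fm: "first_min (\<lambda>i. S n D i j) ({1..m} - {j}) ?p" using t by (simp add: Inv_def)
        have "narr (final scan_body u) ''partner'' j = (if S n D (Suc m) j < S n D ?p j then Suc m else ?p)"
          using new False ne by simp
        then show ?thesis using first_min_insert[OF fm, of "Suc m"] unfolding X by simp
      qed
    qed
    then show "Inv (Suc m) (final scan_body (set_nvar ''i'' (Suc m) t))"
      using ready' j' unfolding Inv_def u_def by blast
  qed
  then have "Inv n (final scan s)" using s0 by (simp add: scan_def s0_def ready_def input_def)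
  moreover have "(if j = 1 then 2 else 1) \<in> {1..n} - {j}" using n by auto
  ultimately have "first_min (\<lambda>i. S n D i j) ({1..n} - {j}) (narr (final scan s) ''partner'' j)"
    unfolding Inv_def by (metis empty_iff)
  then show ?thesis using first_min_partner by simp
qed

lemma check_kept:
  assumes s: "input n D s" and j: "nvar s ''j'' = j" "j \<in> {1..n}"
    and p: "narr s ''partner'' j = partner n D j" "partner n D j \<in> {1..n}"
  shows "narr (final check s) ''kept'' j \<noteq> 0 \<longleftrightarrow> kept n D j"
proof -
  define p where "p = partner n D j"
  define d where "d k = D k p - D k j" for k
  define s0 where "s0 = final (Seq (NSet ''kept'' (NVar ''j'') (NConst 1)) (NSet ''ref'' (NConst 0) (NConst 0))) s"
  \<comment> \<open>The flag records whether all rows met so far agree with the reference row;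
    agreement with one fixed row amounts to being constant.\<close>
  define Inv where "Inv m t \<longleftrightarrow> input n D t \<and> nvar t ''j'' = j \<and> narr t ''partner'' j = p \<and>
    (if {1..m} - {j, p} = {} then narr t ''ref'' 0 = 0 \<and> narr t ''kept'' j \<noteq> 0
     else narr t ''ref'' 0 \<in> {1..m} - {j, p} \<and>
       (narr t ''kept'' j \<noteq> 0 \<longleftrightarrow> (\<forall>k\<in>{1..m} - {j, p}. d k = d (narr t ''ref'' 0))))" for m t
  have "Inv (nval (NVar ''n'') s0) (final (For ''k'' (NVar ''n'') check_body) s0)"
  proof (rule For_invariant)
    show "Inv 0 s0" using s j p by (simp add: Inv_def s0_def p_def input_def)
  next
    fix m t assume "m < nval (NVar ''n'') s0" and t: "Inv m t"
    then have m: "m < n" using s by (simp add: s0_def input_def)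
    define u where "u = set_nvar ''k'' (Suc m) t"
    have u: "input n D u" "nvar u ''j'' = j" "nvar u ''k'' = Suc m" "narr u = narr t"
      using t by (auto simp: Inv_def u_def input_def)
    have fix': "input n D (final check_body u)" "nvar (final check_body u) ''j'' = j"
      "narr (final check_body u) ''partner'' j = p"
      using u t by (auto simp: check_body_def input_def Inv_def)
    have dv: "rval (diff_exp a) u = d (nval a u)" if "nval a u \<in> {1..n}" for a
      using that u t j p by (auto simp: diff_exp_def d_def input_def Inv_def p_def)
    let ?r = "narr t ''ref'' 0"
    let ?Y = "{1..m} - {j, p}"
    have "if {1..Suc m} - {j, p} = {} then narr (final check_body u) ''ref'' 0 = 0 \<and> narr (final check_body u) ''kept'' j \<noteq> 0
     else narr (final check_body u) ''ref'' 0 \<in> {1..Suc m} - {j, p} \<and>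
       (narr (final check_body u) ''kept'' j \<noteq> 0 \<longleftrightarrow>
         (\<forall>k\<in>{1..Suc m} - {j, p}. d k = d (narr (final check_body u) ''ref'' 0)))"
    proof (cases "Suc m \<in> {j, p}")
      case True
      then have X: "{1..Suc m} - {j, p} = ?Y" by (auto simp: le_Suc_eq)
      have eq: "final check_body u = u" using True u t by (auto simp: check_body_def Inv_def)
      show ?thesis unfolding X eq u(4) using t unfolding Inv_def by blast
    next
      case False
      then have X: "{1..Suc m} - {j, p} = insert (Suc m) ?Y" by (auto simp: le_Suc_eq)
      have pt: "narr t ''partner'' j = p" using t by (simp add: Inv_def)
      show ?thesis
      proof (cases "?Y = {}")
        case True
        then have "?r = 0" "narr t ''kept'' j \<noteq> 0" using t by (auto simp: Inv_def)
        then show ?thesis using False u pt unfolding X True by (simp add: check_body_def)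
      next
        case ne: False
        then have r: "?r \<in> ?Y" "narr t ''kept'' j \<noteq> 0 \<longleftrightarrow> (\<forall>k\<in>?Y. d k = d ?r)"
          using t by (auto simp: Inv_def)
        then have r0: "?r \<noteq> 0" by auto
        have dk: "rval (diff_exp (NVar ''k'')) u = d (Suc m)" using dv[of "NVar ''k''"] u m by simp
        have dr: "rval (diff_exp (NArr ''ref'' (NConst 0))) u = d ?r"
          using dv[of "NArr ''ref'' (NConst 0)"] u m r(1) by simp
        have "final check_body u = (if d (Suc m) = d ?r then u else final (NSet ''kept'' (NVar ''j'') (NConst 0)) u)"
          unfolding check_body_def final_simps bval.simps dk dr using False u pt r0 by simp
        then show ?thesis using r r0 u unfolding X by simp
      qed
    qed
    then show "Inv (Suc m) (final check_body (set_nvar ''k'' (Suc m) t))"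
      using fix' unfolding Inv_def u_def by blast
  qed
  then have I: "Inv n (final check s)" using s by (simp add: check_def s0_def input_def)
  show ?thesis
  proof (cases "{1..n} - {j, p} = {}")
    case True
    then have "kept n D j" unfolding kept_def p_def by blast
    then show ?thesis using I True by (simp add: Inv_def)
  next
    case False
    define r where "r = narr (final check s) ''ref'' 0"
    have r: "r \<in> {1..n} - {j, p}"
      "narr (final check s) ''kept'' j \<noteq> 0 \<longleftrightarrow> (\<forall>k\<in>{1..n} - {j, p}. d k = d r)"
      using I False unfolding Inv_def r_def by auto
    have "kept n D j \<longleftrightarrow> (\<exists>c. \<forall>k\<in>{1..n} - {j, p}. d k = c)" by (simp add: kept_def d_def p_def)
    also have "\<dots> \<longleftrightarrow> (\<forall>k\<in>{1..n} - {j, p}. d k = d r)" using r(1) by metis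
    finally show ?thesis using r(2) by simp
  qed
qed

lemma program_correct:
  assumes s: "input n D s" and n: "2 \<le> n"
    and p: "\<And>j. j \<in> {1..n} \<Longrightarrow> partner n D j \<in> {1..n}" and j: "j \<in> {1..n}"
  shows "narr (final program s) ''partner'' j = partner n D j"
    and "narr (final program s) ''kept'' j \<noteq> 0 \<longleftrightarrow> kept n D j"
    and "narr (final program s) ''cherry'' j = (if kept n D j then min j (partner n D j) else 0)"
proof -
  define good where "good t j \<longleftrightarrow> narr t ''partner'' j = partner n D j \<and>
    (narr t ''kept'' j \<noteq> 0 \<longleftrightarrow> kept n D j) \<and>
    narr t ''cherry'' j = (if kept n D j then min j (partner n D j) else 0)" for j and t :: store
  define Inv where "Inv m t \<longleftrightarrow> ready n D t \<and> (\<forall>j\<in>{1..m}. good t j)" for m t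
  define s0 where "s0 = final row_sums s"
  have s0: "ready n D s0" unfolding s0_def by (rule row_sums_ready[OF s])
  have "Inv (nval (NVar ''n'') s0) (final columns s0)"
    unfolding columns_def
  proof (rule For_invariant)
    show "Inv 0 s0" using s0 by (simp add: Inv_def)
  next
    fix m t assume "m < nval (NVar ''n'') s0" and t: "Inv m t"
    then have m: "Suc m \<in> {1..n}" using s0 by (simp add: ready_def input_def)
    let ?c = "Seq scan (Seq check label_cmd)"
    define u where "u = set_nvar ''j'' (Suc m) t"
    have u: "ready n D u" "nvar u ''j'' = Suc m"
      using t ready_set_nvar[of n D t "''j''"] by (auto simp: Inv_def u_def)
    have rd: "ready n D (final ?c u)" by (rule ready_final[OF u(1)]) (auto simp: program_defs)
    define v where "v = final scan u"
    have v: "input n D v" "nvar v ''j'' = Suc m" "narr v ''partner'' (Suc m) = partner n D (Suc m)"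
      using ready_final[OF u(1), of scan] scan_partner[OF u m n] u
      by (auto simp: v_def program_defs ready_def)
    define x where "x = final check v"
    have x: "nvar x ''j'' = Suc m" "narr x ''partner'' (Suc m) = partner n D (Suc m)"
      "narr x ''kept'' (Suc m) \<noteq> 0 \<longleftrightarrow> kept n D (Suc m)"
      using check_kept[OF v(1,2) m v(3) p[OF m]] v by (auto simp: x_def program_defs)
    have new: "good (final ?c u) (Suc m)"
      using x by (auto simp: good_def v_def[symmetric] x_def[symmetric] label_cmd_def)
    \<comment> \<open>Each iteration writes these three arrays only at the current column, so the
      earlier columns keep their results.\<close>
    have old: "narr (final ?c u) a i = narr t a i"
      if "i \<in> {1..m}" "a \<in> {''partner'', ''kept'', ''cherry''}" for a i
    proof -
      have "narr (final ?c u) a i = narr u a i"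
        by (rule narr_final_other[where x = "''j''"]) (use that u(2) in \<open>auto simp: program_defs\<close>)
      then show ?thesis by (simp add: u_def)
    qed
    have "good (final ?c u) i" if "i \<in> {1..m}" for i
      using t that old[OF that] by (auto simp: Inv_def good_def)
    then show "Inv (Suc m) (final ?c (set_nvar ''j'' (Suc m) t))"
      using new rd unfolding Inv_def u_def by (auto simp: le_Suc_eq)
  qed
  then have "Inv n (final program s)"
    using s0 by (simp add: program_def s0_def[symmetric] ready_def input_def)
  then have "good (final program s) j" using j by (simp add: Inv_def)
  then show "narr (final program s) ''partner'' j = partner n D j"
    "narr (final program s) ''kept'' j \<noteq> 0 \<longleftrightarrow> kept n D j"
    "narr (final program s) ''cherry'' j = (if kept n D j then min j (partner n D j) else 0)"
    by (auto simp: good_def)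
qed

section \<open>Leaf-labelled trees\<close>

locale labelled_tree = tree_graph T for T :: "'v graph" +
  fixes w :: "'v set \<Rightarrow> real" and n :: nat and lf :: "nat \<Rightarrow> 'v"
  assumes bij: "bij_betw lf {1..n} (leaves T)" and n3: "3 \<le> n"
    and positive: "internally_positive T w"
begin

lemma card_leaves: "3 \<le> card (leaves T)"
  using bij_betw_same_card[OF bij] n3 by simp

lemma lf_leaf: "i \<in> {1..n} \<Longrightarrow> lf i \<in> leaves T"
  using bij by (auto simp: bij_betw_def)

lemma lf_vert: "i \<in> {1..n} \<Longrightarrow> lf i \<in> verts T"
  using lf_leaf leaf_in_verts by blast

lemma lf_eq_iff: "i \<in> {1..n} \<Longrightarrow> j \<in> {1..n} \<Longrightarrow> lf i = lf j \<longleftrightarrow> i = j"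
  by (rule inj_on_eq_iff[OF bij_betw_imp_inj_on[OF bij]])

lemma leafE: assumes "v \<in> leaves T" obtains i where "i \<in> {1..n}" "v = lf i"
  using assms bij_betw_imp_surj_on[OF bij] by blast

definition internal_edges :: "'v set set" where
  "internal_edges = {e. internal_edge T e}"

text \<open>Leaf 1 serves as the root: \<open>True\<close> names the side of \<open>e\<close> that
  does not contain it.\<close>

definition side :: "'v set \<Rightarrow> nat \<Rightarrow> bool" where
  "side e i \<longleftrightarrow> sep e (lf 1) (lf i)"

lemma sep_side: "i \<in> {1..n} \<Longrightarrow> j \<in> {1..n} \<Longrightarrow> sep e (lf i) (lf j) \<longleftrightarrow> side e i \<noteq> side e j"
  unfolding side_def by (rule sep_cut) (use lf_vert n3 in auto)

lemma leaf_dist_eq: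
  assumes ij: "i \<in> {1..n}" "j \<in> {1..n}"
  shows "leaf_dist T w lf i j = (\<Sum>e\<in>edges T. w e * of_bool (side e i \<noteq> side e j))"
proof -
  have "leaf_dist T w lf i j = sum w (path_edges (P (lf i) (lf j)))"
    by (simp add: leaf_dist_def tree_dist_def P_def)
  also have "path_edges (P (lf i) (lf j)) = {e \<in> edges T. side e i \<noteq> side e j}"
    using sep_side[OF ij] sep_in_edges[OF lf_vert lf_vert, OF ij] by blast
  also have "sum w {e \<in> edges T. side e i \<noteq> side e j} =
      (\<Sum>e\<in>edges T. w e * of_bool (side e i \<noteq> side e j))"
    by (rule sum.mono_neutral_cong_left) (auto simp: finite_edges)
  finally show ?thesis .
qed

lemma pendant_side:
  assumes "e \<in> edges T - internal_edges"
  shows "\<exists>l\<in>{1..n}. \<forall>k\<in>{1..n} - {l}. side e k \<noteq> side e l"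
proof -
  obtain v where v: "v \<in> leaves T" "\<And>k. k \<in> leaves T \<Longrightarrow> k \<noteq> v \<Longrightarrow> sep e v k"
    using pendant_edge assms unfolding internal_edges_def by blast
  obtain l where l: "l \<in> {1..n}" "v = lf l" using v(1) by (rule leafE)
  have "side e k \<noteq> side e l" if "k \<in> {1..n} - {l}" for k
    using v(2)[of "lf k"] sep_side[OF l(1), of k e] that l lf_leaf lf_eq_iff by auto
  then show ?thesis using l(1) by blast
qed

lemma big_side:
  assumes e: "e \<in> internal_edges"
  shows "2 \<le> card {k \<in> {1..n}. side e k = b}"
proof -
  have r: "lf 1 \<in> verts T" using lf_vert n3 by simp
  obtain x y where xy: "e = {x, y}"
    using e edge_cases unfolding internal_edges_def internal_edge_def by blast
  have ed: "{x, y} \<in> edges T" using e xy by (simp add: internal_edges_def internal_edge_def)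
  have "sep e (lf 1) y \<noteq> sep e (lf 1) x" using sep_step[OF r ed, of e] xy by auto
  \<comment> \<open>The ends of \<open>e\<close> lie on different sides, so one of them,
    \<open>z\<close>, is on the side \<open>b\<close>; two leaves not separated from it are then
    there as well.\<close>
  then obtain z z' where z: "e = {z, z'}" "sep e (lf 1) z = b"
    using xy by (metis insert_commute)
  have "internal_edge T {z, z'}" using e z by (simp add: internal_edges_def)
  then obtain l l' where l: "l \<in> leaves T" "l' \<in> leaves T" "l \<noteq> l'"
    "\<not> sep {z, z'} z l" "\<not> sep {z, z'} z l'"
    using internal_edge_two_leaves[OF card_leaves] by blast
  have zv: "z \<in> verts T" using edgeD[of z z'] ed xy z by simp
  obtain i j where ij: "i \<in> {1..n}" "l = lf i" "j \<in> {1..n}" "l' = lf j"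
    using l leafE by metis
  have "side e i = b" "side e j = b"
    using sep_cut[OF r zv lf_vert[OF ij(1)], of e] sep_cut[OF r zv lf_vert[OF ij(3)], of e]
      l ij z by (auto simp: side_def)
  then have "{i, j} \<subseteq> {k \<in> {1..n}. side e k = b}" using ij by auto
  then have "card {i, j} \<le> card {k \<in> {1..n}. side e k = b}" by (intro card_mono) auto
  moreover have "i \<noteq> j" using l ij by auto
  ultimately show ?thesis by simp
qed

lemma compat_side:
  assumes "e \<in> internal_edges" "f \<in> internal_edges" "e \<noteq> f"
  shows "\<exists>b c. \<forall>k\<in>{1..n}. \<not> (side e k = b \<and> side f k = c)"
proof -
  have r: "lf 1 \<in> verts T" using lf_vert n3 by simp
  have ed: "e \<in> edges T" "f \<in> edges T" using assms by (auto simp: internal_edges_def internal_edge_def)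
  obtain x y where xy: "e = {x, y}" using edge_cases[OF ed(1)] by blast
  obtain c d where cd: "f = {c, d}" using edge_cases[OF ed(2)] by blast
  have V: "x \<in> verts T" "c \<in> verts T" using edgeD[of x y] edgeD[of c d] ed xy cd by auto
  \<comment> \<open>The two sides are those away from the other edge: leaves that \<open>e\<close>
    separates from \<open>c\<close>, and leaves that \<open>f\<close> separates from
    \<open>x\<close>. \<open>sep_compat\<close> shows that they do not meet.\<close>
  have "\<not> (side e k = (\<not> sep e (lf 1) c) \<and> side f k = (\<not> sep f (lf 1) x))" if k: "k \<in> {1..n}" for k
  proof
    assume "side e k = (\<not> sep e (lf 1) c) \<and> side f k = (\<not> sep f (lf 1) x)"
    then have "sep e (lf k) c" "sep f (lf k) x"
      using sep_cut[OF r lf_vert[OF k] V(2), of e] sep_cut[OF r lf_vert[OF k] V(1), of f]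
      by (auto simp: side_def)
    then show False using sep_compat[of x y c d "lf k"] assms(3) ed xy cd lf_vert[OF k] by simp
  qed
  then show ?thesis by blast
qed

sublocale split: split_system n "edges T" internal_edges w side "leaf_dist T w lf"
proof
  show "internal_edges \<subseteq> edges T" by (auto simp: internal_edges_def internal_edge_def)
  show "0 < w e" if "e \<in> internal_edges" for e
    using positive that by (simp add: internally_positive_def internal_edges_def)
qed (fact n3 finite_edges leaf_dist_eq pendant_side big_side compat_side)+

lemma rel_iff_linked: "i \<in> {1..n} \<Longrightarrow> j \<in> {1..n} \<Longrightarrow> split.rel i j \<longleftrightarrow> linked (lf i) (lf j)"
  unfolding split.rel_def linked_def by (simp add: sep_side internal_edges_def)

lemma kept_neighbours:
  assumes j: "j \<in> {1..n}" and "kept n (leaf_dist T w lf) j"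
  shows "neighbours T (lf (partner n (leaf_dist T w lf) j)) (lf j)"
  using split.kept_imp_rel[OF assms] split.partner_mem[OF j] j
  by (auto simp: neighbours_iff_linked[OF card_leaves] rel_iff_linked lf_eq_iff lf_leaf)

lemma cherry_iff_rel:
  assumes "A \<subseteq> {1..n}"
  shows "(\<exists>C. cherry T C \<and> leaves C = lf ` A) \<longleftrightarrow> 2 \<le> card A \<and> (\<forall>a\<in>A. \<forall>b\<in>A. split.rel a b)"
proof -
  have "inj_on lf A" using bij assms by (meson bij_betw_imp_inj_on inj_on_subset)
  then have "card (lf ` A) = card A" by (rule card_image)
  moreover have "lf ` A \<subseteq> leaves T" using assms lf_leaf by blast
  moreover have "(\<forall>a\<in>A. \<forall>b\<in>A. split.rel a b) \<longleftrightarrow> (\<forall>u\<in>lf ` A. \<forall>v\<in>lf ` A. linked u v)"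
    using assms rel_iff_linked by (simp add: subset_iff)
  ultimately show ?thesis using cherry_leaf_set_iff[OF card_leaves, of "lf ` A"] by simp
qed

lemma cherry_leaf_kept:
  assumes C: "cherry T C" and j: "j \<in> {1..n}" "lf j \<in> leaves C"
  shows "kept n (leaf_dist T w lf) j"
proof -
  define A where "A = {i \<in> {1..n}. lf i \<in> leaves C}"
  have AN: "A \<subseteq> {1..n}" by (auto simp: A_def)
  have "leaves C = lf ` A"
  proof (intro set_eqI iffI)
    fix v assume v: "v \<in> leaves C"
    then have "v \<in> leaves T" using leaves_cherry_subset[OF card_leaves C] by (rule rev_subsetD)
    then obtain i where "i \<in> {1..n}" "v = lf i" by (rule leafE)
    with v show "v \<in> lf ` A" by (auto simp: A_def)
  qed (auto simp: A_def)
  then have "\<exists>C. cherry T C \<and> leaves C = lf ` A" using C by blast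
  then have A: "2 \<le> card A" "\<forall>a\<in>A. \<forall>b\<in>A. split.rel a b" unfolding cherry_iff_rel[OF AN] by simp_all
  have "\<not> A \<subseteq> {j}" using A(1) card_mono[of "{j}" A] by auto
  then obtain i where "i \<in> A" "i \<noteq> j" by blast
  moreover have "j \<in> A" using j by (simp add: A_def)
  ultimately show ?thesis using A(2) AN split.kept_iff[OF j(1)] by blast
qed

end

lemma labelled_treeI:
  "leaf_labelled_tree T n lf \<Longrightarrow> 3 \<le> n \<Longrightarrow> internally_positive T w \<Longrightarrow> labelled_tree T w n lf"
  by (simp add: leaf_labelled_tree_def labelled_tree_def labelled_tree_axioms_def tree_graph_def)

text \<open>That all cherries are found is expressed by determining which sets of leaves are leaf
  sets of cherries, through the kept couples and through the output of the program. One program and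
  one constant \<open>K\<close> are fixed before the tree, and the bound covers every store with
  \<open>n\<close> at least 1.\<close>

theorem mainTheorem5:
  shows
    "(\<forall>(T :: 'v graph) w n lf D.
        leaf_labelled_tree T n lf \<and> 3 \<le> n \<and> internally_positive T w \<and> D = leaf_dist T w lf \<longrightarrow>
        (\<forall>j\<in>{1..n}. kept n D j \<longrightarrow> neighbours T (lf (partner n D j)) (lf j)) \<and>
        (\<forall>j\<in>{1..n}. \<not> kept n D j \<longrightarrow> (\<nexists>C. cherry T C \<and> lf j \<in> verts C)) \<and>
        (\<forall>C. cherry T C \<longrightarrow>
           (\<forall>v\<in>leaves C. \<exists>j\<in>{1..n}. v = lf j \<and> (partner n D j, j) \<in> kept_couples n D)) \<and>
        (\<forall>A\<subseteq>{1..n}. (\<exists>C. cherry T C \<and> leaves C = lf ` A) \<longleftrightarrow>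
           2 \<le> card A \<and>
           (\<forall>a\<in>A. \<forall>b\<in>A. (a, b) \<in> (kept_couples n D \<union> (kept_couples n D)\<inverse>)\<^sup>*)))
     \<and>
     (\<exists>P. (\<exists>K::nat. \<forall>s. 1 \<le> nvar s ''n'' \<longrightarrow> operations P s \<le> K * (nvar s ''n'')\<^sup>2) \<and>
        (\<forall>(T :: 'v graph) w n lf D s.
           leaf_labelled_tree T n lf \<and> 3 \<le> n \<and> internally_positive T w \<and> D = leaf_dist T w lf \<and>
           input n D s \<longrightarrow>
           (\<forall>j\<in>{1..n}. narr (final P s) ''partner'' j = partner n D j) \<and>
           (\<forall>j\<in>{1..n}. narr (final P s) ''kept'' j \<noteq> 0 \<longleftrightarrow> kept n D j) \<and>
           (\<forall>A\<subseteq>{1..n}. (\<exists>C. cherry T C \<and> leaves C = lf ` A) \<longleftrightarrow>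
              2 \<le> card A \<and>
              (\<exists>c. c \<noteq> 0 \<and> (\<forall>j\<in>A. narr (final P s) ''cherry'' j = c)))))"
proof (intro conjI allI impI)
  fix T :: "'v graph" and w n lf D
  assume h: "leaf_labelled_tree T n lf \<and> 3 \<le> n \<and> internally_positive T w \<and> D = leaf_dist T w lf"
  then interpret labelled_tree T w n lf using labelled_treeI by blast
  have D: "D = leaf_dist T w lf" using h by blast
  show "\<forall>j\<in>{1..n}. kept n D j \<longrightarrow> neighbours T (lf (partner n D j)) (lf j)"
    using kept_neighbours unfolding D by blast
  show "\<forall>j\<in>{1..n}. \<not> kept n D j \<longrightarrow> (\<nexists>C. cherry T C \<and> lf j \<in> verts C)"
    using cherry_leaf_kept leaf_in_cherry[OF card_leaves] lf_leaf unfolding D by blast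
  show "\<forall>v\<in>leaves C. \<exists>j\<in>{1..n}. v = lf j \<and> (partner n D j, j) \<in> kept_couples n D"
    if C: "cherry T C" for C
  proof
    fix v assume v: "v \<in> leaves C"
    then obtain j where j: "j \<in> {1..n}" "v = lf j"
      using leaves_cherry_subset[OF card_leaves C] leafE by (metis subsetD)
    then have "kept n D j" using cherry_leaf_kept[OF C] v D by blast
    then show "\<exists>j\<in>{1..n}. v = lf j \<and> (partner n D j, j) \<in> kept_couples n D"
      using j by (auto simp: kept_couples_def)
  qed
  show "(\<exists>C. cherry T C \<and> leaves C = lf ` A) \<longleftrightarrow>
      2 \<le> card A \<and> (\<forall>a\<in>A. \<forall>b\<in>A. (a, b) \<in> (kept_couples n D \<union> (kept_couples n D)\<inverse>)\<^sup>*)"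
    if "A \<subseteq> {1..n}" for A
    using cherry_iff_rel[OF that] split.rtrancl_kept_couples_iff that unfolding D by (simp add: subset_iff)
next
  show "\<exists>P. (\<exists>K::nat. \<forall>s. 1 \<le> nvar s ''n'' \<longrightarrow> operations P s \<le> K * (nvar s ''n'')\<^sup>2) \<and>
        (\<forall>(T :: 'v graph) w n lf D s.
           leaf_labelled_tree T n lf \<and> 3 \<le> n \<and> internally_positive T w \<and> D = leaf_dist T w lf \<and>
           input n D s \<longrightarrow>
           (\<forall>j\<in>{1..n}. narr (final P s) ''partner'' j = partner n D j) \<and>
           (\<forall>j\<in>{1..n}. narr (final P s) ''kept'' j \<noteq> 0 \<longleftrightarrow> kept n D j) \<and>
           (\<forall>A\<subseteq>{1..n}. (\<exists>C. cherry T C \<and> leaves C = lf ` A) \<longleftrightarrow>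
              2 \<le> card A \<and>
              (\<exists>c. c \<noteq> 0 \<and> (\<forall>j\<in>A. narr (final P s) ''cherry'' j = c))))"
  proof (rule exI[of _ program], intro conjI allI impI)
    show "\<exists>K::nat. \<forall>s. 1 \<le> nvar s ''n'' \<longrightarrow> operations program s \<le> K * (nvar s ''n'')\<^sup>2"
      using program_quadratic by blast
  next
    fix T :: "'v graph" and w n lf D s
    assume h: "leaf_labelled_tree T n lf \<and> 3 \<le> n \<and> internally_positive T w \<and>
      D = leaf_dist T w lf \<and> input n D s"
    then interpret labelled_tree T w n lf using labelled_treeI by blast
    have D: "D = leaf_dist T w lf" and s: "input n D s" using h by blast+
    have mem: "partner n D j \<in> {1..n}" if "j \<in> {1..n}" for j
      using split.partner_mem[OF that] unfolding D by blast
    have "2 \<le> n" using n3 by simp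
    note prog = program_correct[OF s this mem]
    show "\<forall>j\<in>{1..n}. narr (final program s) ''partner'' j = partner n D j"
      "\<forall>j\<in>{1..n}. narr (final program s) ''kept'' j \<noteq> 0 \<longleftrightarrow> kept n D j"
      using prog by blast+
    have "narr (final program s) ''cherry'' j = split.label j" if "j \<in> {1..n}" for j
      using prog(3)[OF _ that] unfolding D split.label_def by blast
    then have "(\<exists>c. c \<noteq> 0 \<and> (\<forall>j\<in>A. narr (final program s) ''cherry'' j = c)) \<longleftrightarrow>
        (\<exists>c. c \<noteq> 0 \<and> (\<forall>j\<in>A. split.label j = c))" if "A \<subseteq> {1..n}" for A
      using that by (simp add: subset_iff)
    note labels = this
    show "(\<exists>C. cherry T C \<and> leaves C = lf ` A) \<longleftrightarrow>
        2 \<le> card A \<and> (\<exists>c. c \<noteq> 0 \<and> (\<forall>j\<in>A. narr (final program s) ''cherry'' j = c))"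
      if A: "A \<subseteq> {1..n}" for A
      unfolding labels[OF A] cherry_iff_rel[OF A] using split.label_iff[OF A] by (rule conj_cong[OF refl, symmetric])
  qed
qed

end
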